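(* Let $p>1$ be odd and let $\epsilon\in\mathbb{C}$ be a primitive $p$th root of unity. For every integer $r\geq 0$, each of the $U_\epsilon^{res}(sl_2)$-submodules $V^{rp}$ and $V^{-rp}$ of $\mathcal{F}_\epsilon^2(2)$ is isomorphic to $V_\epsilon^{res}(-(rp+1))$.
   Context: Let $q$ be an indeterminate, $\mathcal{A}=\mathbb{C}[q,q^{-1}]$, $\mathbb{N}=\{1,2,\dots\}$, $\mathbb{Z}^+=\{0,1,2,\dots\}$. For $n\in\mathbb{Z}$, $m\in\mathbb{N}$: $[n]_q=\frac{q^n-q^{-n}}{q-q^{-1}}$, $[m]_q!=[m]_q\cdots[1]_q$, $\left[{n\atop m}\right]_q=\frac{[n]_q[n-1]_q\cdots[n-m+1]_q}{[m]_q!}$; also $\left[{n\atop 0}\right]_q=1$ and $\left[{n\atop m}\right]_q=0$ for $m<0$. These lie in $\mathcal{A}$, and $\left[{n\atop m}\right]_\epsilon$ denotes the value at $q=\epsilon$. $U_q(sl_2)$ is the associative $\mathbb{C}(q)$-algebra with generators $e,f,K^{\pm1}$ and relations $KK^{-1}=K^{-1}K=1$, $KeK^{-1}=q^2e$, $KfK^{-1}=q^{-2}f$, $[e,f]=\frac{K-K^{-1}}{q-q^{-1}}$. $U_{\mathcal{A}}^{res}(sl_2)$ is its $\mathcal{A}$-subalgebra generated by $K^{\pm1}$, $e^{(r)}=e^r/[r]_q!$, $f^{(r)}=f^r/[r]_q!$ ($r\in\mathbb{N}$). $U_\epsilon^{res}(sl_2)=U_{\mathcal{A}}^{res}(sl_2)\otimes_{\mathcal{A}}\mathbb{C}$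 via $q\mapsto\epsilon$; elements $x\otimes1$ are written $x$. A $U_\epsilon^{res}(sl_2)$-module is of type 1 if $K$ is diagonalizable on it and $K^{\pm p}=1$. Let $\left[{K;0\atop p}\right]_q=\prod_{s=1}^p\frac{Kq^{1-s}-K^{-1}q^{s-1}}{q^s-q^{-s}}\in U_{\mathcal{A}}^{res}(sl_2)$. For $m\in\mathbb{Z}$, the weight space of weight $m$ of a type 1 module $V$ is $\{v\in V: Kv=\epsilon^m v,\ \left[{K;0\atop p}\right]_q v=\left[{m\atop p}\right]_\epsilon v\}$. A type 1 module is a highest weight module of highest weight $\lambda\in\mathbb{Z}$ if it is generated by a nonzero vector $v_\lambda$ of weight $\lambda$ with $ev_\lambda=e^{(p)}v_\lambda=0$. $V_\epsilon^{res}(\lambda)$ denotes the irreducible highest weight module of type 1 of highest weight $\lambda$ (unique up to isomorphism). The restricted q-Fock space $\mathcal{F}_\epsilon^2(2)$ is the complex vector space with basis $\{g(r_1,r_2): r_1,r_2\in\mathbb{Z}^+\}$ (specialization at $q=\epsilon$ of an $\mathcal{A}$-form of the q-Fock space of the rank-2 q-boson algebra, $g(r_1,r_2)=a_1^{+(r_1)}a_2^{+r_2}|0\rangle$). It is a type 1 $U_\epsilon^{res}(sl_2)$-module by (for $r\in\mathbb{N}$) $K^{\pm1}g(r_1,r_2)=\epsilon^{\mp(r_1+r_2+1)}g(r_1,r_2)$, $e^{(r)}g(r_1,r_2)=\left[{r_2\atop r_2-r}\right]_\epsilon g(r_1-r,r_2-r)$, $f^{(r)}g(r_1,r_2)=(-1)^r\left[{r+r_1\atop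 r}\right]_\epsilon g(r_1+r,r_2+r)$, where $g(\cdot,\cdot)$ with a negative index means $0$. For $s\in\mathbb{Z}$, $V^s=\mathrm{span}_{\mathbb{C}}\{g(r_1,r_1+s): r_1\in\mathbb{Z}^+\}$ (with $g$ having a negative index read as $0$); it is a $U_\epsilon^{res}(sl_2)$-submodule of $\mathcal{F}_\epsilon^2(2)$. *)

theory Defs
  imports
    Complex_Main
    "HOL-Computational_Algebra.Fraction_Field"
    "HOL-Computational_Algebra.Polynomial"
    "HOL-Library.Poly_Mapping"
    "HOL-Algebra.Module"
    "HOL-Algebra.QuotRing"
begin

hide_const (open) Rat.Fract

section \<open>Laurent polynomials and q-numbers\<close>

type_synonym Cq = "complex poly fract"

definition qq :: Cq where
  "qq = Fract [:0, 1:] 1"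

definition const :: "complex \<Rightarrow> Cq" where
  "const z = Fract [:z:] 1"

definition laurent :: "Cq set" where
  "laurent = {Fract P 1 / qq ^ n | P n. True}"

text \<open>The value at \<open>q = \<epsilon>\<close> of an element of \<open>laurent\<close>, for \<open>\<epsilon> \<noteq> 0\<close>.\<close>

definition ev :: "complex \<Rightarrow> Cq \<Rightarrow> complex" where
  "ev \<epsilon> a = (THE z. \<exists>P n. a = Fract P 1 / qq ^ n \<and> z = poly P \<epsilon> / \<epsilon> ^ n)"

definition qint :: "int \<Rightarrow> Cq" where
  "qint n = (qq powi n - qq powi (- n)) / (qq - inverse qq)"

definition qfact :: "nat \<Rightarrow> Cq" where
  "qfact m = (\<Prod>i=1..m. qint (int i))"

definition qbinom :: "int \<Rightarrow> int \<Rightarrow> Cq" where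
  "qbinom n m = (if m < 0 then 0 else (\<Prod>i<nat m. qint (n - int i)) / qfact (nat m))"

lemma Fract_pow: "Fract P 1 ^ n = Fract (P ^ n) 1"
  by (induction n) (simp_all add: One_fract_def)

lemma qq_nonzero [simp]: "qq \<noteq> 0"
  by (simp add: qq_def Zero_fract_def eq_fract)

lemma Fract_1_inj: "Fract P 1 = Fract Q 1 \<longleftrightarrow> P = Q"
  by (simp add: eq_fract)

lemma laurentI: "Fract P 1 / qq ^ n \<in> laurent"
  by (auto simp: laurent_def)

lemma laurent_eq_iff:
  "Fract P 1 / qq ^ n = Fract Q 1 / qq ^ m \<longleftrightarrow> P * [:0, 1:] ^ m = Q * [:0, 1:] ^ n"
proof -
  have "Fract P 1 / qq ^ n = Fract Q 1 / qq ^ m \<longleftrightarrow> Fract P 1 * qq ^ m = Fract Q 1 * qq ^ n"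
    by (simp add: frac_eq_eq)
  also have "\<dots> \<longleftrightarrow> P * [:0, 1:] ^ m = Q * [:0, 1:] ^ n"
    by (simp add: qq_def Fract_pow Fract_1_inj)
  finally show ?thesis .
qed

lemma ev_Fract:
  assumes "\<epsilon> \<noteq> 0"
  shows "ev \<epsilon> (Fract P 1 / qq ^ n) = poly P \<epsilon> / \<epsilon> ^ n"
  unfolding ev_def
proof (rule the_equality)
  show "\<exists>Q m. Fract P 1 / qq ^ n = Fract Q 1 / qq ^ m \<and> poly P \<epsilon> / \<epsilon> ^ n = poly Q \<epsilon> / \<epsilon> ^ m"
    by blast
next
  fix z assume "\<exists>Q m. Fract P 1 / qq ^ n = Fract Q 1 / qq ^ m \<and> z = poly Q \<epsilon> / \<epsilon> ^ m"
  then obtain Q m where Q: "P * [:0, 1:] ^ m = Q * [:0, 1:] ^ n" "z = poly Q \<epsilon> / \<epsilon> ^ m"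
    by (auto simp: laurent_eq_iff)
  have "poly (P * [:0, 1:] ^ m) \<epsilon> = poly (Q * [:0, 1:] ^ n) \<epsilon>"
    by (simp only: Q(1))
  then show "z = poly P \<epsilon> / \<epsilon> ^ n"
    using assms Q(2) by (simp add: frac_eq_eq)
qed

lemma laurent_add_form:
  "Fract P 1 / qq ^ n + Fract Q 1 / qq ^ m
     = Fract (P * [:0, 1:] ^ m + Q * [:0, 1:] ^ n) 1 / qq ^ (n + m)"
proof -
  have "Fract P 1 / qq ^ n + Fract Q 1 / qq ^ m
     = (Fract P 1 * qq ^ m + Fract Q 1 * qq ^ n) / qq ^ (n + m)"
    by (simp add: field_simps power_add)
  then show ?thesis by (simp add: qq_def Fract_pow)
qed

lemma laurent_mult_form:
  "(Fract P 1 / qq ^ n) * (Fract Q 1 / qq ^ m) = Fract (P * Q) 1 / qq ^ (n + m)"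
proof -
  have "(Fract P 1 / qq ^ n) * (Fract Q 1 / qq ^ m) = (Fract P 1 * Fract Q 1) / qq ^ (n + m)"
    by (simp only: times_divide_times_eq power_add)
  then show ?thesis by simp
qed

lemma laurent_add [intro]: "a \<in> laurent \<Longrightarrow> b \<in> laurent \<Longrightarrow> a + b \<in> laurent"
  using laurent_add_form laurentI by (fastforce simp: laurent_def)

lemma laurent_mult [intro]: "a \<in> laurent \<Longrightarrow> b \<in> laurent \<Longrightarrow> a * b \<in> laurent"
  using laurent_mult_form laurentI by (fastforce simp: laurent_def)

lemma ev_add:
  assumes "\<epsilon> \<noteq> 0" "a \<in> laurent" "b \<in> laurent"
  shows "ev \<epsilon> (a + b) = ev \<epsilon> a + ev \<epsilon> b"
proof -
  obtain P n Q m where "a = Fract P 1 / qq ^ n" "b = Fract Q 1 / qq ^ m"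
    using assms by (auto simp: laurent_def)
  then show ?thesis
    using assms(1)
    by (simp only: laurent_add_form ev_Fract[OF assms(1)]) (simp add: add_frac_eq power_add)
qed

lemma ev_mult:
  assumes "\<epsilon> \<noteq> 0" "a \<in> laurent" "b \<in> laurent"
  shows "ev \<epsilon> (a * b) = ev \<epsilon> a * ev \<epsilon> b"
proof -
  obtain P n Q m where "a = Fract P 1 / qq ^ n" "b = Fract Q 1 / qq ^ m"
    using assms by (auto simp: laurent_def)
  then show ?thesis
    by (simp only: laurent_mult_form ev_Fract[OF assms(1)]) (simp add: power_add)
qed

lemma const_laurent [simp, intro]: "const z \<in> laurent"
  using laurentI[of "[:z:]" 0] by (simp add: const_def)

lemma ev_const [simp]: "\<epsilon> \<noteq> 0 \<Longrightarrow> ev \<epsilon> (const z) = z"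
  using ev_Fract[of \<epsilon> "[:z:]" 0] by (simp add: const_def)

lemma const_0 [simp]: "const 0 = 0" and const_1 [simp]: "const 1 = 1"
  by (simp_all add: const_def Zero_fract_def One_fract_def eq_fract one_pCons)

lemma const_add: "const (x + y) = const x + const y"
  and const_mult: "const (x * y) = const x * const y"
  and const_uminus: "const (- x) = - const x"
  by (simp_all add: const_def mult.commute)

lemma laurent_0 [simp, intro]: "0 \<in> laurent" and laurent_1 [simp, intro]: "1 \<in> laurent"
  using const_laurent[of 0] const_laurent[of 1] by simp_all

lemma ev_0 [simp]: "\<epsilon> \<noteq> 0 \<Longrightarrow> ev \<epsilon> 0 = 0" and ev_1 [simp]: "\<epsilon> \<noteq> 0 \<Longrightarrow> ev \<epsilon> 1 = 1"
  using ev_const[of \<epsilon> 0] ev_const[of \<epsilon> 1] by simp_all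

lemma laurent_uminus [intro]: "a \<in> laurent \<Longrightarrow> - a \<in> laurent"
  using laurent_mult[OF const_laurent[of "-1"], of a] by (simp add: const_uminus)

lemma laurent_diff [intro]: "a \<in> laurent \<Longrightarrow> b \<in> laurent \<Longrightarrow> a - b \<in> laurent"
  using laurent_add[OF _ laurent_uminus, of a b] by simp

lemma ev_uminus: "\<epsilon> \<noteq> 0 \<Longrightarrow> a \<in> laurent \<Longrightarrow> ev \<epsilon> (- a) = - ev \<epsilon> a"
  using ev_mult[OF _ const_laurent[of "-1"], of \<epsilon> a] ev_const[of \<epsilon> "-1"]
  by (simp add: const_uminus)

lemma ev_diff: "\<epsilon> \<noteq> 0 \<Longrightarrow> a \<in> laurent \<Longrightarrow> b \<in> laurent \<Longrightarrow> ev \<epsilon> (a - b) = ev \<epsilon> a - ev \<epsilon> b"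
  using ev_add[OF _ _ laurent_uminus, of \<epsilon> a b] by (simp add: ev_uminus)

lemma laurent_qq [simp, intro]: "qq \<in> laurent"
  using laurentI[of "[:0, 1:]" 0] by (simp add: qq_def)

lemma ev_qq [simp]: "\<epsilon> \<noteq> 0 \<Longrightarrow> ev \<epsilon> qq = \<epsilon>"
  using ev_Fract[of \<epsilon> "[:0, 1:]" 0] by (simp add: qq_def)

lemma laurent_qq_powi [simp, intro]: "qq powi n \<in> laurent"
proof (cases "n \<ge> 0")
  case True
  then show ?thesis
    using laurentI[of "[:0, 1:] ^ nat n" 0] by (simp add: qq_def Fract_pow power_int_def)
next
  case False
  then show ?thesis
    using laurentI[of 1 "nat (- n)"]
    by (simp add: power_int_def power_inverse divide_inverse flip: One_fract_def)
qed

lemma ev_qq_powi [simp]: "\<epsilon> \<noteq> 0 \<Longrightarrow> ev \<epsilon> (qq powi n) = \<epsilon> powi n"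
proof (cases "n \<ge> 0")
  case True
  assume "\<epsilon> \<noteq> 0"
  then show ?thesis
    using True ev_Fract[of \<epsilon> "[:0, 1:] ^ nat n" 0] by (simp add: qq_def Fract_pow power_int_def)
next
  case False
  assume "\<epsilon> \<noteq> 0"
  then show ?thesis
    using False ev_Fract[of \<epsilon> 1 "nat (- n)"]
    by (simp add: power_int_def power_inverse divide_inverse flip: One_fract_def)
qed

lemma ev_eq_0_iff:
  assumes "\<epsilon> \<noteq> 0" "a \<in> laurent"
  shows "ev \<epsilon> a = 0 \<longleftrightarrow> (\<exists>b\<in>laurent. a = (qq - const \<epsilon>) * b)"
proof
  assume 0: "ev \<epsilon> a = 0"
  obtain P n where a: "a = Fract P 1 / qq ^ n" using assms by (auto simp: laurent_def)
  with 0 assms(1) have "poly P \<epsilon> = 0" by (simp add: ev_Fract)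
  then obtain Q where "P = [:- \<epsilon>, 1:] * Q" by (metis poly_eq_0_iff_dvd dvdE)
  moreover have "qq - const \<epsilon> = Fract [:- \<epsilon>, 1:] 1" by (simp add: qq_def const_def)
  ultimately have "a = (qq - const \<epsilon>) * (Fract Q 1 / qq ^ n)" by (simp add: a)
  then show "\<exists>b\<in>laurent. a = (qq - const \<epsilon>) * b" using laurentI by blast
next
  assume "\<exists>b\<in>laurent. a = (qq - const \<epsilon>) * b"
  then show "ev \<epsilon> a = 0" using assms by (auto simp: ev_mult ev_diff laurent_diff)
qed

lemma qq_powi_neq_1:
  assumes "n > 0" shows "qq powi n \<noteq> 1"
proof
  assume "qq powi n = 1"
  then have "Fract ([:0, 1:] ^ nat n) 1 = (Fract 1 1 :: Cq)"
    using assms by (simp add: power_int_def qq_def Fract_pow One_fract_def)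
  then have "poly ([:0, 1:] ^ nat n) (0::complex) = poly 1 0" by (simp add: Fract_1_inj)
  then show False using assms by (simp add: zero_power)
qed

lemma qq_neq_inverse [simp]: "qq \<noteq> inverse qq"
proof
  assume "qq = inverse qq"
  then have "qq * qq = 1" by (metis qq_nonzero right_inverse)
  then show False using qq_powi_neq_1[of 2] by (simp add: power_int_def power2_eq_square)
qed

lemma qint_nonzero: "n > 0 \<Longrightarrow> qint n \<noteq> 0"
proof
  assume n: "n > 0" and "qint n = 0"
  then have "qq powi n = qq powi (- n)" by (simp add: qint_def)
  then have "qq powi (n + n) = 1"
    by (metis power_int_add power_int_minus power_int_eq_0_iff qq_nonzero right_inverse)
  then show False using qq_powi_neq_1[of "n + n"] n by simp
qed

lemma qint_0 [simp]: "qint 0 = 0"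
  by (simp add: qint_def)

lemma qint_1 [simp]: "qint 1 = 1"
  by (simp add: qint_def power_int_minus)

lemma qfact_nonzero [simp]: "qfact m \<noteq> 0"
  by (simp add: qfact_def qint_nonzero)

lemma qfact_Suc: "qfact (Suc m) = qfact m * qint (int (Suc m))"
  by (simp add: qfact_def)

lemma qint_add:
  "qint (a + b) = qq powi a * qint b + qq powi (- b) * qint a"
proof -
  have "qq powi a * (qq powi b - qq powi (- b)) + qq powi (- b) * (qq powi a - qq powi (- a))
      = qq powi (a + b) - qq powi (- a + - b)"
    by (subst (1 2) power_int_add) (simp_all add: algebra_simps)
  then show ?thesis
    by (simp add: qint_def flip: add_divide_distrib)
qed

lemma qbinom_0 [simp]: "qbinom n 0 = 1"
  by (simp add: qbinom_def qfact_def)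

lemma qbinom_pascal:
  "qbinom (n + 1) (int (Suc m))
     = qq powi (int m + 1) * qbinom n (int (Suc m)) + qq powi (int m - n) * qbinom n (int m)"
proof -
  define N where "N = (\<Prod>i<m. qint (n - int i))"
  have shift: "(\<Prod>i<Suc m. qint (n + 1 - int i)) = qint (n + 1) * N"
    unfolding N_def by (subst prod.lessThan_Suc_shift) simp
  have e: "qint (n + 1)
      = qq powi (int m + 1) * qint (n - int m) + qq powi (int m - n) * qint (int m + 1)"
    using qint_add[of "int m + 1" "n - int m"] by (simp add: algebra_simps)
  have "qbinom (n + 1) (int (Suc m)) = qint (n + 1) * N / qfact (Suc m)"
    using shift by (simp add: qbinom_def nat_add_distrib del: prod.lessThan_Suc)
  also have "\<dots> = qq powi (int m + 1) * (N * qint (n - int m) / qfact (Suc m))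
      + qq powi (int m - n) * (N * qint (int m + 1) / qfact (Suc m))"
    unfolding e by (simp add: add_divide_distrib ring_distribs mult_ac)
  also have "N * qint (int m + 1) / qfact (Suc m) = N / qfact m"
    using qint_nonzero[of "1 + int m"] by (simp add: qfact_Suc add.commute)
  also have "N * qint (n - int m) / qfact (Suc m) = qbinom n (int (Suc m))"
    by (simp add: qbinom_def nat_add_distrib N_def)
  also have "N / qfact m = qbinom n (int m)"
    by (simp add: qbinom_def N_def)
  finally show ?thesis .
qed

lemma qbinom_laurent [simp, intro]: "qbinom n m \<in> laurent"
proof -
  have "qbinom n (int k) \<in> laurent" for k n
  proof (induction k arbitrary: n)
    case (Suc k)
    show ?case
    proof (induction n rule: int_induct[where k = 0])
      case base
      have "(\<Prod>i<Suc k. qint (0 - int i)) = 0"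
        by (rule prod_zero[OF finite_lessThan]) (rule bexI[of _ 0], simp_all)
      then have "qbinom 0 (int (Suc k)) = 0"
        by (simp add: qbinom_def nat_add_distrib del: prod.lessThan_Suc)
      then show ?case by simp
    next
      case (step1 n)
      then show ?case by (subst qbinom_pascal) (intro laurent_add laurent_mult Suc laurent_qq_powi)
    next
      case (step2 n)
      have "qq powi (int k + 1) * qbinom (n - 1) (int (Suc k))
          = qbinom n (int (Suc k)) - qq powi (int k - (n - 1)) * qbinom (n - 1) (int k)"
        using qbinom_pascal[of "n - 1" k] by simp
      then have "qbinom (n - 1) (int (Suc k)) = qq powi (- (int k + 1)) *
          (qbinom n (int (Suc k)) - qq powi (int k - (n - 1)) * qbinom (n - 1) (int k))"
        by (metis (no_types, lifting) mult.assoc mult_1 power_int_0_right power_int_add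
            qq_nonzero add.commute add.right_inverse)
      then show ?case
        using step2 by (simp only:) (intro laurent_diff laurent_mult Suc laurent_qq_powi)
    qed
  qed simp
  from this[of n "nat m"] show ?thesis
    by (cases "m < 0") (auto simp: qbinom_def)
qed


section \<open>The algebra \<open>U\<^sub>q(sl\<^sub>2)\<close>\<close>

text \<open>
  Expressions over the generators with scalars in \<open>\<complex>(q)\<close>, modulo the smallest congruence
  containing the axioms of an associative unital \<open>\<complex>(q)\<close>-algebra and the defining relations
  of \<open>U\<^sub>q(sl\<^sub>2)\<close>.
\<close>

datatype uq_expr =
    Scal Cq | GenE | GenF | GenK | GenKi
  | Add uq_expr uq_expr | Mul uq_expr uq_expr

inductive uq_rel :: "uq_expr \<Rightarrow> uq_expr \<Rightarrow> bool" where
  refl: "uq_rel x x"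
| sym: "uq_rel x y \<Longrightarrow> uq_rel y x"
| trans: "uq_rel x y \<Longrightarrow> uq_rel y z \<Longrightarrow> uq_rel x z"
| add_cong: "uq_rel x x' \<Longrightarrow> uq_rel y y' \<Longrightarrow> uq_rel (Add x y) (Add x' y')"
| mul_cong: "uq_rel x x' \<Longrightarrow> uq_rel y y' \<Longrightarrow> uq_rel (Mul x y) (Mul x' y')"
| add_assoc: "uq_rel (Add (Add x y) z) (Add x (Add y z))"
| add_comm: "uq_rel (Add x y) (Add y x)"
| add_zero: "uq_rel (Add (Scal 0) x) x"
| mul_assoc: "uq_rel (Mul (Mul x y) z) (Mul x (Mul y z))"
| mul_one: "uq_rel (Mul (Scal 1) x) x"
| mul_zero: "uq_rel (Mul (Scal 0) x) (Scal 0)"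
| distl: "uq_rel (Mul x (Add y z)) (Add (Mul x y) (Mul x z))"
| distr: "uq_rel (Mul (Add x y) z) (Add (Mul x z) (Mul y z))"
| scal_add: "uq_rel (Scal (a + b)) (Add (Scal a) (Scal b))"
| scal_mul: "uq_rel (Scal (a * b)) (Mul (Scal a) (Scal b))"
| scal_central: "uq_rel (Mul x (Scal a)) (Mul (Scal a) x)"
| K_Ki: "uq_rel (Mul GenK GenKi) (Scal 1)"
| Ki_K: "uq_rel (Mul GenKi GenK) (Scal 1)"
| K_E: "uq_rel (Mul (Mul GenK GenE) GenKi) (Mul (Scal (qq powi 2)) GenE)"
| K_F: "uq_rel (Mul (Mul GenK GenF) GenKi) (Mul (Scal (qq powi (-2))) GenF)"
| E_F: "uq_rel (Add (Mul GenE GenF) (Mul (Scal (-1)) (Mul GenF GenE)))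
    (Mul (Scal (1 / (qq - inverse qq))) (Add GenK (Mul (Scal (-1)) GenKi)))"

text \<open>
  The generic q-Fock space on coefficient functions (\<open>\<phi> i j\<close> is the coefficient of
  \<open>g(i, j)\<close>). It is used here only to show that the relations do not force \<open>0 = 1\<close>, and
  below to construct the restricted q-Fock space.
\<close>

primrec act :: "uq_expr \<Rightarrow> (nat \<Rightarrow> nat \<Rightarrow> Cq) \<Rightarrow> nat \<Rightarrow> nat \<Rightarrow> Cq" where
  "act (Scal a) \<phi> = (\<lambda>i j. a * \<phi> i j)"
| "act GenE \<phi> = (\<lambda>i j. qint (int j + 1) * \<phi> (Suc i) (Suc j))"
| "act GenF \<phi> = (\<lambda>i j. if i = 0 \<or> j = 0 then 0 else - qint (int i) * \<phi> (i - 1) (j - 1))"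
| "act GenK \<phi> = (\<lambda>i j. qq powi (- (int i + int j + 1)) * \<phi> i j)"
| "act GenKi \<phi> = (\<lambda>i j. qq powi (int i + int j + 1) * \<phi> i j)"
| "act (Add x y) \<phi> = (\<lambda>i j. act x \<phi> i j + act y \<phi> i j)"
| "act (Mul x y) \<phi> = act x (act y \<phi>)"

lemma act_add: "act x (\<lambda>i j. \<phi> i j + \<psi> i j) = (\<lambda>i j. act x \<phi> i j + act x \<psi> i j)"
proof (induction x arbitrary: \<phi> \<psi>)
  case (Mul x y)
  then show ?case by simp
qed (auto simp: fun_eq_iff algebra_simps)

lemma act_scale: "act x (\<lambda>i j. a * \<phi> i j) = (\<lambda>i j. a * act x \<phi> i j)"
proof (induction x arbitrary: \<phi>)
  case (Mul x y)
  then show ?case by simp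
qed (auto simp: fun_eq_iff algebra_simps)

lemma qint_comm:
  "qint (a + 1) * qint (b + 1) - qint a * qint b = qint (a + b + 1)"
proof -
  have "qint (a + 1) = qq powi a + inverse qq * qint a"
    using qint_add[of a 1] by simp
  moreover have "qint (a + (b + 1)) = qq powi a * qint (b + 1) + qq powi (- (b + 1)) * qint a"
    by (rule qint_add)
  moreover have "qint (b + 1) = qq * qint b + qq powi (- b)"
    using qint_add[of 1 b] by (simp add: add.commute)
  moreover have "qq powi (- (b + 1)) = inverse qq * qq powi (- b)"
    using power_int_add[of qq "- b" "- 1"] by simp
  ultimately show ?thesis
    by (simp add: algebra_simps)
qed

lemma act_rel: "uq_rel x y \<Longrightarrow> act x = act y"
proof (induction rule: uq_rel.induct)
  case K_Ki
  then show ?case by (auto simp: fun_eq_iff simp flip: power_int_add mult.assoc)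
next
  case Ki_K
  then show ?case by (auto simp: fun_eq_iff simp flip: power_int_add mult.assoc)
next
  case K_E
  show ?case
  proof (intro ext)
    fix \<phi> i j
    have "act (Mul (Mul GenK GenE) GenKi) \<phi> i j
        = (qq powi (- (int i + int j + 1)) * qq powi (int (Suc i) + int (Suc j) + 1))
          * (qint (int j + 1) * \<phi> (Suc i) (Suc j))"
      by (simp only: act.simps mult_ac)
    also have "qq powi (- (int i + int j + 1)) * qq powi (int (Suc i) + int (Suc j) + 1) = qq powi 2"
      by (simp flip: power_int_add)
    finally show "act (Mul (Mul GenK GenE) GenKi) \<phi> i j = act (Mul (Scal (qq powi 2)) GenE) \<phi> i j"
      by (simp only: act.simps)
  qed
next
  case K_F
  show ?case
  proof (intro ext)
    fix \<phi> i j
    show "act (Mul (Mul GenK GenF) GenKi) \<phi> i j = act (Mul (Scal (qq powi (- 2))) GenF) \<phi> i j"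
    proof (cases "i = 0 \<or> j = 0")
      case False
      then obtain i' j' where ij: "i = Suc i'" "j = Suc j'" by (metis not0_implies_Suc)
      have "act (Mul (Mul GenK GenF) GenKi) \<phi> i j
          = (qq powi (- (int (Suc i') + int (Suc j') + 1)) * qq powi (int i' + int j' + 1))
            * (- qint (int (Suc i')) * \<phi> i' j')"
        unfolding ij by (simp only: act.simps mult_ac diff_Suc_1 nat.distinct simp_thms if_False)
      also have "qq powi (- (int (Suc i') + int (Suc j') + 1)) * qq powi (int i' + int j' + 1)
          = qq powi (- 2)" by (simp flip: power_int_add)
      finally show ?thesis
        unfolding ij by (simp only: act.simps diff_Suc_1 nat.distinct simp_thms if_False)
    qed auto
  qed
next
  case E_F
  show ?case
  proof (intro ext)
    fix \<phi> i j
    have "act (Add (Mul GenE GenF) (Mul (Scal (-1)) (Mul GenF GenE))) \<phi> i j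
        = - (qint (int i + 1) * qint (int j + 1) - qint (int i) * qint (int j)) * \<phi> i j"
    proof (cases "i = 0 \<or> j = 0")
      case False
      then obtain i' j' where ij: "i = Suc i'" "j = Suc j'" by (metis not0_implies_Suc)
      then show ?thesis by (simp add: algebra_simps)
    qed (auto simp: algebra_simps)
    also have "\<dots> = - qint (int i + int j + 1) * \<phi> i j"
      by (simp only: qint_comm)
    also have "\<dots> = act (Mul (Scal (1 / (qq - inverse qq)))
        (Add GenK (Mul (Scal (-1)) GenKi))) \<phi> i j"
      by (simp add: qint_def algebra_simps diff_divide_distrib)
    finally show "act (Add (Mul GenE GenF) (Mul (Scal (-1)) (Mul GenF GenE))) \<phi> i j
      = act (Mul (Scal (1 / (qq - inverse qq))) (Add GenK (Mul (Scal (-1)) GenKi))) \<phi> i j" .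
  qed
next
  case (mul_cong x x' y y')
  then show ?case by (intro ext) simp
qed (auto simp: fun_eq_iff act_add act_scale algebra_simps)

quotient_type uq = uq_expr / uq_rel
  by (intro equivpI reflpI sympI transpI) (blast intro: uq_rel.refl uq_rel.sym uq_rel.trans)+

lift_definition uact :: "uq \<Rightarrow> (nat \<Rightarrow> nat \<Rightarrow> Cq) \<Rightarrow> nat \<Rightarrow> nat \<Rightarrow> Cq" is act
  by (rule act_rel)

lift_definition sc :: "Cq \<Rightarrow> uq" is Scal .
lift_definition uE :: uq is GenE .
lift_definition uF :: uq is GenF .
lift_definition uK :: uq is GenK .
lift_definition uKi :: uq is GenKi .

instantiation uq :: ring_1
begin

lift_definition zero_uq :: uq is "Scal 0" .
lift_definition one_uq :: uq is "Scal 1" .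
lift_definition plus_uq :: "uq \<Rightarrow> uq \<Rightarrow> uq" is Add by (rule uq_rel.add_cong)
lift_definition times_uq :: "uq \<Rightarrow> uq \<Rightarrow> uq" is Mul by (rule uq_rel.mul_cong)

definition uminus_uq :: "uq \<Rightarrow> uq" where
  "uminus_uq x = sc (- 1) * x"

definition minus_uq :: "uq \<Rightarrow> uq \<Rightarrow> uq" where
  "minus_uq x y = x + - y"

instance
proof
  fix a b c :: uq
  show ac: "a + b + c = a + (b + c)" by transfer (rule uq_rel.add_assoc)
  show co: "a + b = b + a" by transfer (rule uq_rel.add_comm)
  show "0 + a = a" by transfer (rule uq_rel.add_zero)
  show "a * b * c = a * (b * c)" by transfer (rule uq_rel.mul_assoc)
  show one: "1 * a = a" by transfer (rule uq_rel.mul_one)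
  show "a * 1 = a"
    by transfer (rule uq_rel.trans[OF uq_rel.scal_central uq_rel.mul_one])
  show "(a + b) * c = a * c + b * c" by transfer (rule uq_rel.distr)
  show "a * (b + c) = a * b + a * c" by transfer (rule uq_rel.distl)
  show "a - b = a + - b" by (simp add: minus_uq_def)
  have "sc (-1) * a + 1 * a = (sc (-1) + 1) * a"
    by transfer (rule uq_rel.sym[OF uq_rel.distr])
  also have "sc (-1) + 1 = sc (-1 + 1)"
    by transfer (rule uq_rel.sym[OF uq_rel.scal_add])
  also have "sc (-1 + 1) * a = 0"
    by simp (transfer, rule uq_rel.mul_zero)
  finally show "- a + a = 0" by (simp add: uminus_uq_def one)
  show "(0::uq) \<noteq> 1"
  proof
    assume "(0::uq) = 1"
    then have "uact 0 (\<lambda>_ _. 1) 0 0 = uact 1 (\<lambda>_ _. 1) 0 0" by simp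
    then show False by transfer simp
  qed
qed

end

lemma sc_0: "sc 0 = 0" and sc_1: "sc 1 = 1"
  by (simp_all add: sc_def zero_uq_def one_uq_def)

lemma sc_add: "sc (a + b) = sc a + sc b"
  by transfer (rule uq_rel.scal_add)

lemma sc_mult: "sc (a * b) = sc a * sc b"
  by transfer (rule uq_rel.scal_mul)

lemma sc_central: "x * sc a = sc a * x"
  by transfer (rule uq_rel.scal_central)

lemma uq_relations:
  "uK * uKi = 1"
  "uKi * uK = 1"
  "uK * uE * uKi = sc (qq powi 2) * uE"
  "uK * uF * uKi = sc (qq powi (-2)) * uF"
  "uE * uF - uF * uE = sc (1 / (qq - inverse qq)) * (uK - uKi)"
proof -
  show "uK * uKi = 1" by transfer (rule uq_rel.K_Ki)
  show "uKi * uK = 1" by transfer (rule uq_rel.Ki_K)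
  show "uK * uE * uKi = sc (qq powi 2) * uE" by transfer (rule uq_rel.K_E)
  show "uK * uF * uKi = sc (qq powi (-2)) * uF" by transfer (rule uq_rel.K_F)
  have "uE * uF + sc (-1) * (uF * uE) = sc (1 / (qq - inverse qq)) * (uK + sc (-1) * uKi)"
    by transfer (rule uq_rel.E_F)
  then show "uE * uF - uF * uE = sc (1 / (qq - inverse qq)) * (uK - uKi)"
    by (simp add: minus_uq_def uminus_uq_def)
qed

definition divE :: "nat \<Rightarrow> uq" where
  "divE r = sc (1 / qfact r) * uE ^ r"

definition divF :: "nat \<Rightarrow> uq" where
  "divF r = sc (1 / qfact r) * uF ^ r"

text \<open>\<open>[K;0, p]\<^sub>q\<close>; its factors commute with each other.\<close>

definition Kbinom :: "nat \<Rightarrow> uq" where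
  "Kbinom p = prod_list (map (\<lambda>s. sc (1 / (qq powi int s - qq powi (- int s))) *
     (sc (qq powi (1 - int s)) * uK - sc (qq powi (int s - 1)) * uKi)) [1..<Suc p])"


section \<open>The restricted integral form and its specialization\<close>

inductive_set Ures :: "uq set" where
  scal: "a \<in> laurent \<Longrightarrow> sc a \<in> Ures"
| K: "uK \<in> Ures"
| Ki: "uKi \<in> Ures"
| E: "r \<ge> 1 \<Longrightarrow> divE r \<in> Ures"
| F: "r \<ge> 1 \<Longrightarrow> divF r \<in> Ures"
| add: "x \<in> Ures \<Longrightarrow> y \<in> Ures \<Longrightarrow> x + y \<in> Ures"
| mult: "x \<in> Ures \<Longrightarrow> y \<in> Ures \<Longrightarrow> x * y \<in> Ures"

definition Ures_ring :: "uq ring" where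
  "Ures_ring = \<lparr>carrier = Ures, mult = (*), one = 1, zero = 0, add = (+)\<rparr>"

definition spec_ideal :: "complex \<Rightarrow> uq set" where
  "spec_ideal \<epsilon> = {sc (qq - const \<epsilon>) * u | u. u \<in> Ures}"

text \<open>
  \<open>U\<^sub>\<A>\<^sup>r\<^sup>e\<^sup>s \<otimes>\<^sub>\<A> \<complex>\<close>: the map \<open>\<A> \<rightarrow> \<complex>\<close>, \<open>q \<mapsto> \<epsilon>\<close>, is onto with kernel
  \<open>(q - \<epsilon>)\<A>\<close> (lemma \<open>ev_eq_0_iff\<close>), so the base change is the quotient by
  \<open>(q - \<epsilon>)U\<^sub>\<A>\<^sup>r\<^sup>e\<^sup>s\<close>. The universal property of the tensor product is proved below
  (\<open>Ueps_balanced\<close> and \<open>Ueps_universal\<close>); \<open>cls \<epsilon> x\<close> is \<open>x \<otimes> 1\<close>.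
\<close>

definition Ueps :: "complex \<Rightarrow> uq set ring" where
  "Ueps \<epsilon> = Ures_ring Quot (spec_ideal \<epsilon>)"

definition cls :: "complex \<Rightarrow> uq \<Rightarrow> uq set" where
  "cls \<epsilon> u = spec_ideal \<epsilon> +>\<^bsub>Ures_ring\<^esub> u"

lemma Ures_ring_simps [simp]:
  "carrier Ures_ring = Ures" "mult Ures_ring = (*)" "one Ures_ring = 1"
  "zero Ures_ring = 0" "add Ures_ring = (+)"
  by (simp_all add: Ures_ring_def)

lemma sc_uminus: "sc (- a) = - sc a"
  by (metis add.right_inverse eq_neg_iff_add_eq_0 sc_0 sc_add)

lemma Ures_uminus: "x \<in> Ures \<Longrightarrow> - x \<in> Ures"
  using Ures.mult[OF Ures.scal[OF laurent_uminus[OF laurent_1]], of x] by (simp add: sc_uminus sc_1)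

lemma Ures_0 [simp, intro]: "0 \<in> Ures" and Ures_1 [simp, intro]: "1 \<in> Ures"
  using Ures.scal[of 0] Ures.scal[of 1] by (simp_all add: sc_0 sc_1)

lemma ring_Ures: "ring Ures_ring"
proof (rule ringI)
  show "abelian_group Ures_ring"
  proof (rule abelian_groupI)
    fix x assume "x \<in> carrier Ures_ring"
    then show "\<exists>y\<in>carrier Ures_ring. y \<oplus>\<^bsub>Ures_ring\<^esub> x = \<zero>\<^bsub>Ures_ring\<^esub>"
      by (intro bexI[of _ "- x"]) (auto intro: Ures_uminus)
  qed (auto intro: Ures.add simp: algebra_simps)
  show "Group.monoid Ures_ring"
    by (rule monoidI) (auto intro: Ures.mult simp: algebra_simps)
qed (auto simp: algebra_simps)

lemma spec_ideal_Ures: "x \<in> spec_ideal \<epsilon> \<Longrightarrow> x \<in> Ures"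
  by (auto simp: spec_ideal_def intro!: Ures.mult Ures.scal laurent_diff)

lemma ideal_spec: "ideal (spec_ideal \<epsilon>) Ures_ring"
proof (rule idealI[OF ring_Ures])
  interpret R: ring Ures_ring by (rule ring_Ures)
  have minv: "inv\<^bsub>add_monoid Ures_ring\<^esub> x = - x" if "x \<in> Ures" for x
    using that R.minus_equality[of "- x" x] by (simp add: a_inv_def Ures_uminus)
  show "subgroup (spec_ideal \<epsilon>) (add_monoid Ures_ring)"
  proof
    show "spec_ideal \<epsilon> \<subseteq> carrier (add_monoid Ures_ring)" by (auto dest: spec_ideal_Ures)
    show "x \<otimes>\<^bsub>add_monoid Ures_ring\<^esub> y \<in> spec_ideal \<epsilon>"
      if "x \<in> spec_ideal \<epsilon>" "y \<in> spec_ideal \<epsilon>" for x y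
      using that by (auto simp: spec_ideal_def) (metis Ures.add distrib_left)
    show "\<one>\<^bsub>add_monoid Ures_ring\<^esub> \<in> spec_ideal \<epsilon>"
      by (auto simp: spec_ideal_def intro!: exI[of _ 0])
    show "inv\<^bsub>add_monoid Ures_ring\<^esub> x \<in> spec_ideal \<epsilon>" if "x \<in> spec_ideal \<epsilon>" for x
      using that minv[OF spec_ideal_Ures[OF that]]
      by (auto simp: spec_ideal_def) (metis Ures_uminus mult_minus_right)
  qed
  show "x \<otimes>\<^bsub>Ures_ring\<^esub> a \<in> spec_ideal \<epsilon>"
    if "a \<in> spec_ideal \<epsilon>" "x \<in> carrier Ures_ring" for a x
    using that by (auto simp: spec_ideal_def) (metis Ures.mult mult.assoc sc_central)
  show "a \<otimes>\<^bsub>Ures_ring\<^esub> x \<in> spec_ideal \<epsilon>"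
    if "a \<in> spec_ideal \<epsilon>" "x \<in> carrier Ures_ring" for a x
    using that by (auto simp: spec_ideal_def) (metis Ures.mult mult.assoc)
qed

lemma ring_Ueps: "ring (Ueps \<epsilon>)"
  unfolding Ueps_def by (rule ideal.quotient_is_ring[OF ideal_spec])

lemma carrier_Ueps: "carrier (Ueps \<epsilon>) = cls \<epsilon> ` Ures"
  by (auto simp: Ueps_def FactRing_def A_RCOSETS_def' cls_def)

lemma cls_add: "x \<in> Ures \<Longrightarrow> y \<in> Ures \<Longrightarrow> cls \<epsilon> x \<oplus>\<^bsub>Ueps \<epsilon>\<^esub> cls \<epsilon> y = cls \<epsilon> (x + y)"
  using ideal.a_rcos_sum[OF ideal_spec, of x y]
  by (simp add: Ueps_def FactRing_def cls_def)

lemma cls_mult: "x \<in> Ures \<Longrightarrow> y \<in> Ures \<Longrightarrow> cls \<epsilon> x \<otimes>\<^bsub>Ueps \<epsilon>\<^esub> cls \<epsilon> y = cls \<epsilon> (x * y)"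
  using ideal.rcoset_mult_add[OF ideal_spec, of x y]
  by (simp add: Ueps_def FactRing_def cls_def)

lemma cls_eq_iff:
  assumes "x \<in> Ures" "y \<in> Ures"
  shows "cls \<epsilon> x = cls \<epsilon> y \<longleftrightarrow> (\<exists>u\<in>Ures. x = y + sc (qq - const \<epsilon>) * u)"
proof -
  interpret I: ideal "spec_ideal \<epsilon>" Ures_ring by (rule ideal_spec)
  have mem: "z \<in> cls \<epsilon> w \<longleftrightarrow> (\<exists>u\<in>Ures. z = w + sc (qq - const \<epsilon>) * u)" for z w
    by (auto simp: cls_def a_r_coset_def r_coset_def spec_ideal_def add.commute)
  have "x \<in> cls \<epsilon> x" by (auto simp: mem intro!: bexI[of _ 0])
  moreover have "x \<in> cls \<epsilon> y \<Longrightarrow> cls \<epsilon> x = cls \<epsilon> y"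
    using I.a_repr_independence'[of x y] assms(2) unfolding cls_def by simp
  ultimately show ?thesis by (auto simp flip: mem)
qed

lemma one_Ueps: "\<one>\<^bsub>Ueps \<epsilon>\<^esub> = cls \<epsilon> 1" and zero_Ueps: "\<zero>\<^bsub>Ueps \<epsilon>\<^esub> = cls \<epsilon> 0"
proof -
  interpret I: ideal "spec_ideal \<epsilon>" Ures_ring by (rule ideal_spec)
  show "\<one>\<^bsub>Ueps \<epsilon>\<^esub> = cls \<epsilon> 1" by (simp add: Ueps_def FactRing_def cls_def)
  show "\<zero>\<^bsub>Ueps \<epsilon>\<^esub> = cls \<epsilon> 0"
    by (auto simp: Ueps_def FactRing_def cls_def a_r_coset_def r_coset_def)
qed

definition tens :: "complex \<Rightarrow> uq \<Rightarrow> complex \<Rightarrow> uq set" where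
  "tens \<epsilon> u z = cls \<epsilon> (sc (const z) * u)"

lemma Ueps_balanced:
  assumes "\<epsilon> \<noteq> 0" "u \<in> Ures" "v \<in> Ures"
  shows "tens \<epsilon> u z \<in> carrier (Ueps \<epsilon>)"
    and "tens \<epsilon> (u + v) z = tens \<epsilon> u z \<oplus>\<^bsub>Ueps \<epsilon>\<^esub> tens \<epsilon> v z"
    and "tens \<epsilon> u (z + w) = tens \<epsilon> u z \<oplus>\<^bsub>Ueps \<epsilon>\<^esub> tens \<epsilon> u w"
    and "a \<in> laurent \<Longrightarrow> tens \<epsilon> (sc a * u) z = tens \<epsilon> u (ev \<epsilon> a * z)"
    and "tens \<epsilon> u z \<otimes>\<^bsub>Ueps \<epsilon>\<^esub> tens \<epsilon> v w = tens \<epsilon> (u * v) (z * w)"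
proof -
  have c: "sc (const z) * x \<in> Ures" if "x \<in> Ures" for z x
    using that by (intro Ures.mult Ures.scal const_laurent)
  show "tens \<epsilon> u z \<in> carrier (Ueps \<epsilon>)"
    using c assms by (auto simp: tens_def carrier_Ueps)
  show "tens \<epsilon> (u + v) z = tens \<epsilon> u z \<oplus>\<^bsub>Ueps \<epsilon>\<^esub> tens \<epsilon> v z"
    using c assms by (simp add: tens_def cls_add distrib_left)
  show "tens \<epsilon> u (z + w) = tens \<epsilon> u z \<oplus>\<^bsub>Ueps \<epsilon>\<^esub> tens \<epsilon> u w"
    using c assms by (simp add: tens_def cls_add const_add sc_add distrib_right)
  have "sc (const z) * u * (sc (const w) * v) = sc (const (z * w)) * (u * v)"
    by (metis const_mult mult.assoc sc_central sc_mult)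
  then show "tens \<epsilon> u z \<otimes>\<^bsub>Ueps \<epsilon>\<^esub> tens \<epsilon> v w = tens \<epsilon> (u * v) (z * w)"
    using c assms by (simp add: tens_def cls_mult)
  assume a: "a \<in> laurent"
  then have "ev \<epsilon> (const z * a - const (ev \<epsilon> a * z)) = 0"
    using assms by (simp add: ev_diff ev_mult laurent_mult)
  then obtain b where b: "b \<in> laurent" "const z * a - const (ev \<epsilon> a * z) = (qq - const \<epsilon>) * b"
    using ev_eq_0_iff[OF assms(1), of "const z * a - const (ev \<epsilon> a * z)"] a
    by (auto intro!: laurent_diff laurent_mult)
  then have "const z * a = const (ev \<epsilon> a * z) + (qq - const \<epsilon>) * b" by (simp add: algebra_simps)
  then have "sc (const z) * (sc a * u) = sc (const (ev \<epsilon> a * z)) * u + sc (qq - const \<epsilon>) * (sc b * u)"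
    by (metis distrib_right mult.assoc sc_add sc_mult)
  moreover have "sc b * u \<in> Ures" "sc a * u \<in> Ures"
    using a b assms by (auto intro!: Ures.mult Ures.scal)
  ultimately show "tens \<epsilon> (sc a * u) z = tens \<epsilon> u (ev \<epsilon> a * z)"
    unfolding tens_def using c assms(2) cls_eq_iff by blast
qed

lemma Ueps_universal:
  fixes \<beta> :: "uq \<Rightarrow> complex \<Rightarrow> 'g::ab_group_add"
  assumes "\<epsilon> \<noteq> 0"
    and addl: "\<And>u v z. u \<in> Ures \<Longrightarrow> v \<in> Ures \<Longrightarrow> \<beta> (u + v) z = \<beta> u z + \<beta> v z"
    and addr: "\<And>u z w. u \<in> Ures \<Longrightarrow> \<beta> u (z + w) = \<beta> u z + \<beta> u w"
    and bal: "\<And>a u z. a \<in> laurent \<Longrightarrow> u \<in> Ures \<Longrightarrow> \<beta> (sc a * u) z = \<beta> u (ev \<epsilon> a * z)"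
  shows "\<exists>h. (\<forall>X\<in>carrier (Ueps \<epsilon>). \<forall>Y\<in>carrier (Ueps \<epsilon>). h (X \<oplus>\<^bsub>Ueps \<epsilon>\<^esub> Y) = h X + h Y) \<and>
      (\<forall>u\<in>Ures. \<forall>z. h (tens \<epsilon> u z) = \<beta> u z) \<and>
      (\<forall>h'. (\<forall>u\<in>Ures. \<forall>z. h' (tens \<epsilon> u z) = \<beta> u z) \<longrightarrow> (\<forall>X\<in>carrier (Ueps \<epsilon>). h' X = h X))"
proof -
  define h where "h X = \<beta> (SOME u. u \<in> Ures \<and> X = cls \<epsilon> u) 1" for X
  have b0: "\<beta> u 0 = 0" if "u \<in> Ures" for u
    using addr[OF that, of 0 0] by simp
  have wd: "\<beta> u 1 = \<beta> v 1" if uv: "u \<in> Ures" "v \<in> Ures" "cls \<epsilon> u = cls \<epsilon> v" for u v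
  proof -
    obtain w where w: "w \<in> Ures" "u = v + sc (qq - const \<epsilon>) * w" using uv cls_eq_iff by blast
    have "\<beta> u 1 = \<beta> v 1 + \<beta> w (ev \<epsilon> (qq - const \<epsilon>) * 1)"
      unfolding w(2) using w uv
      by (subst addl) (auto intro!: Ures.mult Ures.scal laurent_diff simp: bal laurent_diff)
    then show ?thesis using assms(1) w by (simp add: ev_diff b0)
  qed
  have hcls: "h (cls \<epsilon> u) = \<beta> u 1" if "u \<in> Ures" for u
  proof -
    have "(SOME v. v \<in> Ures \<and> cls \<epsilon> u = cls \<epsilon> v) \<in> Ures \<and>
        cls \<epsilon> u = cls \<epsilon> (SOME v. v \<in> Ures \<and> cls \<epsilon> u = cls \<epsilon> v)"
      by (rule someI[of _ u]) (use that in auto)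
    then show ?thesis unfolding h_def using wd that by metis
  qed
  have 1: "h (tens \<epsilon> u z) = \<beta> u z" if "u \<in> Ures" for u z
    unfolding tens_def using that assms(1)
    by (subst hcls) (auto intro!: Ures.mult Ures.scal simp: bal)
  have 2: "h (X \<oplus>\<^bsub>Ueps \<epsilon>\<^esub> Y) = h X + h Y"
    if "X \<in> carrier (Ueps \<epsilon>)" "Y \<in> carrier (Ueps \<epsilon>)" for X Y
    using that by (auto simp: carrier_Ueps cls_add hcls addl Ures.add)
  have 3: "h' X = h X"
    if h': "\<forall>u\<in>Ures. \<forall>z. h' (tens \<epsilon> u z) = \<beta> u z" and X: "X \<in> carrier (Ueps \<epsilon>)" for h' X
  proof -
    obtain u where u: "u \<in> Ures" "X = cls \<epsilon> u" using X by (auto simp: carrier_Ueps)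
    then have "X = tens \<epsilon> u 1" by (simp add: tens_def sc_1)
    then show ?thesis using h' u(1) 1 by metis
  qed
  show ?thesis using 1 2 3 by blast
qed


section \<open>Modules\<close>

text \<open>The locale \<open>module\<close> of HOL-Algebra requires a commutative ring.\<close>

locale left_module = R?: ring R + M?: abelian_group M for R (structure) and M (structure) +
  assumes smult_closed:
      "\<lbrakk>a \<in> carrier R; x \<in> carrier M\<rbrakk> \<Longrightarrow> a \<odot>\<^bsub>M\<^esub> x \<in> carrier M"
    and smult_l_distr:
      "\<lbrakk>a \<in> carrier R; b \<in> carrier R; x \<in> carrier M\<rbrakk> \<Longrightarrow>
      (a \<oplus> b) \<odot>\<^bsub>M\<^esub> x = a \<odot>\<^bsub>M\<^esub> x \<oplus>\<^bsub>M\<^esub> b \<odot>\<^bsub>M\<^esub> x"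
    and smult_r_distr:
      "\<lbrakk>a \<in> carrier R; x \<in> carrier M; y \<in> carrier M\<rbrakk> \<Longrightarrow>
      a \<odot>\<^bsub>M\<^esub> (x \<oplus>\<^bsub>M\<^esub> y) = a \<odot>\<^bsub>M\<^esub> x \<oplus>\<^bsub>M\<^esub> a \<odot>\<^bsub>M\<^esub> y"
    and smult_assoc:
      "\<lbrakk>a \<in> carrier R; b \<in> carrier R; x \<in> carrier M\<rbrakk> \<Longrightarrow>
      (a \<otimes> b) \<odot>\<^bsub>M\<^esub> x = a \<odot>\<^bsub>M\<^esub> (b \<odot>\<^bsub>M\<^esub> x)"
    and smult_one:
      "x \<in> carrier M \<Longrightarrow> \<one> \<odot>\<^bsub>M\<^esub> x = x"

definition irreducible_module :: "('a, 'c) ring_scheme \<Rightarrow> ('a, 'b) module \<Rightarrow> bool" where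
  "irreducible_module R M \<longleftrightarrow> left_module R M \<and> carrier M \<noteq> {\<zero>\<^bsub>M\<^esub>} \<and>
     (\<forall>H. submodule H R M \<longrightarrow> H = {\<zero>\<^bsub>M\<^esub>} \<or> H = carrier M)"

definition module_iso ::
    "('a, 'd) ring_scheme \<Rightarrow> ('a, 'b) module \<Rightarrow> ('a, 'c) module \<Rightarrow> bool" where
  "module_iso R M N \<longleftrightarrow> (\<exists>h. bij_betw h (carrier M) (carrier N) \<and>
     (\<forall>x\<in>carrier M. \<forall>y\<in>carrier M. h (x \<oplus>\<^bsub>M\<^esub> y) = h x \<oplus>\<^bsub>N\<^esub> h y) \<and>
     (\<forall>a\<in>carrier R. \<forall>x\<in>carrier M. h (a \<odot>\<^bsub>M\<^esub> x) = a \<odot>\<^bsub>N\<^esub> h x))"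

text \<open>
  The complex vector space structure of a module over the \<open>\<complex>\<close>-algebra \<open>U\<^sub>\<epsilon>\<^sup>r\<^sup>e\<^sup>s\<close> is the
  one through \<open>z \<mapsto> z \<cdot> 1\<close>.
\<close>

definition cscale :: "complex \<Rightarrow> (uq set, 'b) module \<Rightarrow> complex \<Rightarrow> 'b \<Rightarrow> 'b" where
  "cscale \<epsilon> M z v = cls \<epsilon> (sc (const z)) \<odot>\<^bsub>M\<^esub> v"

definition type1 :: "complex \<Rightarrow> nat \<Rightarrow> (uq set, 'b) module \<Rightarrow> bool" where
  "type1 \<epsilon> p M \<longleftrightarrow> left_module (Ueps \<epsilon>) M \<and>
     (\<forall>v\<in>carrier M. \<exists>S. finite S \<and>
        S \<subseteq> {w \<in> carrier M. \<exists>c. cls \<epsilon> uK \<odot>\<^bsub>M\<^esub> w = cscale \<epsilon> M c w} \<and>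
        v = finsum M (\<lambda>w. w) S) \<and>
     (\<forall>v\<in>carrier M. cls \<epsilon> (uK ^ p) \<odot>\<^bsub>M\<^esub> v = v \<and> cls \<epsilon> (uKi ^ p) \<odot>\<^bsub>M\<^esub> v = v)"

definition weight_space :: "complex \<Rightarrow> nat \<Rightarrow> (uq set, 'b) module \<Rightarrow> int \<Rightarrow> 'b set" where
  "weight_space \<epsilon> p M m = {v \<in> carrier M.
     cls \<epsilon> uK \<odot>\<^bsub>M\<^esub> v = cscale \<epsilon> M (\<epsilon> powi m) v \<and>
     cls \<epsilon> (Kbinom p) \<odot>\<^bsub>M\<^esub> v = cscale \<epsilon> M (ev \<epsilon> (qbinom m (int p))) v}"

definition highest_weight_module :: "complex \<Rightarrow> nat \<Rightarrow> (uq set, 'b) module \<Rightarrow> int \<Rightarrow> bool" where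
  "highest_weight_module \<epsilon> p M l \<longleftrightarrow> type1 \<epsilon> p M \<and>
     (\<exists>v\<in>weight_space \<epsilon> p M l. v \<noteq> \<zero>\<^bsub>M\<^esub> \<and>
        cls \<epsilon> uE \<odot>\<^bsub>M\<^esub> v = \<zero>\<^bsub>M\<^esub> \<and> cls \<epsilon> (divE p) \<odot>\<^bsub>M\<^esub> v = \<zero>\<^bsub>M\<^esub> \<and>
        carrier M = {x \<odot>\<^bsub>M\<^esub> v | x. x \<in> carrier (Ueps \<epsilon>)})"

text \<open>
  \<open>V\<^sub>\<epsilon>\<^sup>r\<^sup>e\<^sup>s(\<lambda>)\<close> is only determined up to isomorphism;
  \<open>is_Vres \<epsilon> p M \<lambda>\<close> says that the module \<open>M\<close> is a copy of it.
\<close>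

definition is_Vres :: "complex \<Rightarrow> nat \<Rightarrow> (uq set, 'b) module \<Rightarrow> int \<Rightarrow> bool" where
  "is_Vres \<epsilon> p M l \<longleftrightarrow> highest_weight_module \<epsilon> p M l \<and> irreducible_module (Ueps \<epsilon>) M"


section \<open>The restricted q-Fock space\<close>

type_synonym fock = "(nat \<times> nat) \<Rightarrow>\<^sub>0 complex"

definition fscale :: "complex \<Rightarrow> fock \<Rightarrow> fock" where
  "fscale z = Poly_Mapping.map ((*) z)"

definition gvec :: "int \<Rightarrow> int \<Rightarrow> fock" where
  "gvec i j = (if i < 0 \<or> j < 0 then 0 else Poly_Mapping.single (nat i, nat j) 1)"

text \<open>
  The formulas determine the action of \<open>U\<^sub>\<epsilon>\<^sup>r\<^sup>e\<^sup>s\<close>, which is generated by \<open>\<complex>\<close>,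
  \<open>K\<^sup>\<plusminus>\<^sup>1\<close> and the divided powers. Such an action exists: \<open>restricted_fock_exists\<close> below.
\<close>

definition restricted_fock :: "complex \<Rightarrow> (uq set, fock) module \<Rightarrow> bool" where
  "restricted_fock \<epsilon> M \<longleftrightarrow> left_module (Ueps \<epsilon>) M \<and>
     carrier M = UNIV \<and> add M = (+) \<and> zero M = 0 \<and>
     (\<forall>z v. cscale \<epsilon> M z v = fscale z v) \<and>
     (\<forall>i\<ge>0. \<forall>j\<ge>0.
        cls \<epsilon> uK \<odot>\<^bsub>M\<^esub> gvec i j = fscale (\<epsilon> powi (- (i + j + 1))) (gvec i j) \<and>
        cls \<epsilon> uKi \<odot>\<^bsub>M\<^esub> gvec i j = fscale (\<epsilon> powi (i + j + 1)) (gvec i j) \<and>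
        (\<forall>r\<ge>1. cls \<epsilon> (divE r) \<odot>\<^bsub>M\<^esub> gvec i j
            = fscale (ev \<epsilon> (qbinom j (j - int r))) (gvec (i - int r) (j - int r)) \<and>
          cls \<epsilon> (divF r) \<odot>\<^bsub>M\<^esub> gvec i j
            = fscale ((-1) ^ r * ev \<epsilon> (qbinom (int r + i) (int r))) (gvec (i + int r) (j + int r))))"

definition Vs :: "(uq set, fock) module \<Rightarrow> int \<Rightarrow> (uq set, fock) module" where
  "Vs M s = M\<lparr>carrier := module.span fscale {gvec i (i + s) | i. i \<ge> 0}\<rparr>"

lemma lookup_fscale [simp]: "Poly_Mapping.lookup (fscale z v) x = z * Poly_Mapping.lookup v x"
  by (simp add: fscale_def map.rep_eq when_def)

lemma vector_space_fscale: "vector_space fscale"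
  by (rule vector_space.intro) (auto intro!: poly_mapping_eqI simp: lookup_add algebra_simps)

lemma lookup_gvec:
  "Poly_Mapping.lookup (gvec a b) (i, j) = (if int i = a \<and> int j = b then 1 else 0)"
  by (auto simp: gvec_def lookup_single when_def)

lemma uact_sc: "uact (sc a) \<phi> = (\<lambda>i j. a * \<phi> i j)"
  and uact_E: "uact uE \<phi> = (\<lambda>i j. qint (int j + 1) * \<phi> (Suc i) (Suc j))"
  and uact_F: "uact uF \<phi> = (\<lambda>i j. if i = 0 \<or> j = 0 then 0 else - qint (int i) * \<phi> (i - 1) (j - 1))"
  and uact_K: "uact uK \<phi> = (\<lambda>i j. qq powi (- (int i + int j + 1)) * \<phi> i j)"
  and uact_Ki: "uact uKi \<phi> = (\<lambda>i j. qq powi (int i + int j + 1) * \<phi> i j)"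
  by (simp_all add: sc_def uE_def uF_def uK_def uKi_def uact.abs_eq)

lemma uact_plus: "uact (x + y) \<phi> = (\<lambda>i j. uact x \<phi> i j + uact y \<phi> i j)"
  by (induct x rule: uq.abs_induct, induct y rule: uq.abs_induct)
    (simp add: plus_uq.abs_eq uact.abs_eq)

lemma uact_times: "uact (x * y) \<phi> = uact x (uact y \<phi>)"
  by (induct x rule: uq.abs_induct, induct y rule: uq.abs_induct)
    (simp add: times_uq.abs_eq uact.abs_eq)

lemma uact_1: "uact 1 \<phi> = \<phi>"
  using uact_sc[of 1] by (simp add: sc_1)

lemma uact_add: "uact x (\<lambda>i j. \<phi> i j + \<psi> i j) = (\<lambda>i j. uact x \<phi> i j + uact x \<psi> i j)"
  by (induct x rule: uq.abs_induct) (simp add: uact.abs_eq act_add)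

lemma uact_finite:
  assumes "finite {(i, j). \<phi> i j \<noteq> 0}"
  shows "finite {(i, j). uact x \<phi> i j \<noteq> 0}"
proof -
  have "finite {(i, j). act y \<phi> i j \<noteq> 0}" if "finite {(i, j). \<phi> i j \<noteq> 0}" for y \<phi>
    using that
  proof (induction y arbitrary: \<phi>)
    case GenE
    have "{(i, j). act GenE \<phi> i j \<noteq> 0} \<subseteq> (\<lambda>(i, j). (i - 1, j - 1)) ` {(i, j). \<phi> i j \<noteq> 0}"
      by (force simp: image_iff)
    then show ?case using GenE finite_surj by blast
  next
    case GenF
    have "{(i, j). act GenF \<phi> i j \<noteq> 0} \<subseteq> (\<lambda>(i, j). (Suc i, Suc j)) ` {(i, j). \<phi> i j \<noteq> 0}"
    proof clarify
      fix i j assume *: "act GenF \<phi> i j \<noteq> 0"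
      then have "i \<noteq> 0" "j \<noteq> 0" "\<phi> (i - 1) (j - 1) \<noteq> 0" by (auto split: if_splits)
      then show "(i, j) \<in> (\<lambda>(i, j). (Suc i, Suc j)) ` {(i, j). \<phi> i j \<noteq> 0}"
        by (intro image_eqI[of _ _ "(i - 1, j - 1)"]) auto
    qed
    then show ?case using GenF finite_surj by blast
  next
    case (Add x y)
    have "{(i, j). act (Add x y) \<phi> i j \<noteq> 0}
        \<subseteq> {(i, j). act x \<phi> i j \<noteq> 0} \<union> {(i, j). act y \<phi> i j \<noteq> 0}" by auto
    then show ?case using Add finite_subset by (metis (no_types, lifting) finite_Un)
  qed (auto elim!: rev_finite_subset)
  with assms show ?thesis
    by (induct x rule: uq.abs_induct) (simp add: uact.abs_eq)
qed

lemma qbinom_qfact: "qbinom (int (a + b)) (int a) = qfact (a + b) / (qfact a * qfact b)"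
proof -
  have "qfact b * (\<Prod>i<a. qint (int (a + b) - int i)) = qfact (a + b)"
  proof (induction a)
    case (Suc a)
    have "(\<Prod>i<Suc a. qint (int (Suc a + b) - int i))
        = qint (int (Suc (a + b))) * (\<Prod>i<a. qint (int (a + b) - int i))"
      by (subst prod.lessThan_Suc_shift) simp
    then show ?case using Suc by (simp add: qfact_Suc mult_ac del: prod.lessThan_Suc)
  qed simp
  then show ?thesis by (simp add: qbinom_def field_simps)
qed

lemma uact_divE: "uact (divE r) \<phi> i j = qbinom (int (j + r)) (int j) * \<phi> (i + r) (j + r)"
proof -
  have "uact (uE ^ r) \<phi> i j = qfact (j + r) / qfact j * \<phi> (i + r) (j + r)"
  proof (induction r arbitrary: i j)
    case (Suc r)
    show ?case
      by (simp add: uact_times uact_E Suc qfact_Suc qint_nonzero field_simps)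
  qed (simp add: uact_1)
  moreover have "qbinom (int (j + r)) (int j) = qfact (j + r) / (qfact j * qfact r)"
    by (rule qbinom_qfact)
  ultimately show ?thesis by (simp add: divE_def uact_times uact_sc del: of_nat_add)
qed

lemma uact_divF: "uact (divF r) \<phi> i j = (if r \<le> i \<and> r \<le> j
    then (- 1) ^ r * qbinom (int i) (int r) * \<phi> (i - r) (j - r) else 0)"
proof -
  have "uact (uF ^ r) \<phi> i j
      = (if r \<le> i \<and> r \<le> j then (- 1) ^ r * (qfact i / qfact (i - r)) * \<phi> (i - r) (j - r) else 0)"
  proof (induction r arbitrary: i j)
    case (Suc r)
    show ?case
    proof (cases "i = 0 \<or> j = 0")
      case False
      then obtain i' j' where "i = Suc i'" "j = Suc j'" by (metis not0_implies_Suc)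
      then show ?thesis
        by (simp add: uact_times uact_F Suc qfact_Suc)
    qed (auto simp: uact_times uact_F)
  qed (simp add: uact_1)
  moreover have "qbinom (int i) (int r) = qfact i / (qfact r * qfact (i - r))" if "r \<le> i"
    using qbinom_qfact[of r "i - r"] that by simp
  ultimately show ?thesis by (simp add: divF_def uact_times uact_sc)
qed

lemma uact_Ures:
  fixes \<epsilon> :: complex
  assumes "\<epsilon> \<noteq> 0" "u \<in> Ures"
  shows "(\<And>i j. \<phi> i j \<in> laurent) \<Longrightarrow> (\<And>i j. \<psi> i j \<in> laurent) \<Longrightarrow>
    (\<And>i j. ev \<epsilon> (\<phi> i j) = ev \<epsilon> (\<psi> i j)) \<Longrightarrow>
    uact u \<phi> i j \<in> laurent \<and> ev \<epsilon> (uact u \<phi> i j) = ev \<epsilon> (uact u \<psi> i j)"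
  using assms(2)
proof (induction u arbitrary: \<phi> \<psi> i j)
  case (add x y)
  have "uact x \<phi> i j \<in> laurent" "uact x \<psi> i j \<in> laurent"
    "ev \<epsilon> (uact x \<phi> i j) = ev \<epsilon> (uact x \<psi> i j)"
    using add(3)[of \<phi> \<psi>] add(3)[of \<psi> \<psi>] add.prems by auto
  moreover have "uact y \<phi> i j \<in> laurent" "uact y \<psi> i j \<in> laurent"
    "ev \<epsilon> (uact y \<phi> i j) = ev \<epsilon> (uact y \<psi> i j)"
    using add(4)[of \<phi> \<psi>] add(4)[of \<psi> \<psi>] add.prems by auto
  ultimately show ?case using assms(1) by (auto simp: uact_plus ev_add)
next
  case (mult x y)
  have "uact y \<phi> i j \<in> laurent" "uact y \<psi> i j \<in> laurent"
    "ev \<epsilon> (uact y \<phi> i j) = ev \<epsilon> (uact y \<psi> i j)" for i j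
    using mult(4)[of \<phi> \<psi>] mult(4)[of \<psi> \<psi>] mult.prems by auto
  then show ?case unfolding uact_times by (intro mult(3))
next
  case (F r)
  then show ?case
    using assms(1) laurent_mult[OF laurent_mult, of "(- 1) ^ r" "qbinom (int i) (int r)"]
    by (cases "even r") (auto simp: uact_divF ev_mult ev_uminus laurent_mult)
qed (use assms(1) in \<open>auto simp: uact_sc uact_K uact_Ki uact_divE ev_mult simp del: of_nat_add\<close>)

definition fock_lift :: "fock \<Rightarrow> nat \<Rightarrow> nat \<Rightarrow> Cq" where
  "fock_lift v i j = const (Poly_Mapping.lookup v (i, j))"

definition fock_act :: "complex \<Rightarrow> uq \<Rightarrow> fock \<Rightarrow> fock" where
  "fock_act \<epsilon> u v = Abs_poly_mapping (\<lambda>(i, j). ev \<epsilon> (uact u (fock_lift v) i j))"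

lemma const_eq_0 [simp]: "const z = 0 \<longleftrightarrow> z = 0"
  by (simp add: const_def Zero_fract_def eq_fract)

lemma lookup_fock_act:
  assumes "\<epsilon> \<noteq> 0"
  shows "Poly_Mapping.lookup (fock_act \<epsilon> u v) (i, j) = ev \<epsilon> (uact u (fock_lift v) i j)"
proof -
  have "{(i, j). fock_lift v i j \<noteq> 0} = {x. Poly_Mapping.lookup v x \<noteq> 0}"
    by (auto simp: fock_lift_def)
  then have "finite {(i, j). fock_lift v i j \<noteq> 0}"
    by (simp add: finite_lookup)
  then have "finite {(i, j). uact u (fock_lift v) i j \<noteq> 0}"
    by (rule uact_finite)
  then have "finite {x. (case x of (i, j) \<Rightarrow> ev \<epsilon> (uact u (fock_lift v) i j)) \<noteq> 0}"
    by (rule rev_finite_subset) (use assms in auto)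
  then show ?thesis by (simp add: fock_act_def)
qed

lemma fock_act_times:
  assumes "\<epsilon> \<noteq> 0" "x \<in> Ures" "y \<in> Ures"
  shows "fock_act \<epsilon> (x * y) v = fock_act \<epsilon> x (fock_act \<epsilon> y v)"
proof (rule poly_mapping_eqI, clarify)
  fix i j
  have l: "fock_lift w i j \<in> laurent" for w i j by (simp add: fock_lift_def)
  have "ev \<epsilon> (uact x (uact y (fock_lift v)) i j) = ev \<epsilon> (uact x (fock_lift (fock_act \<epsilon> y v)) i j)"
    using uact_Ures[OF assms(1,3), of "fock_lift v" "fock_lift v"] assms(1)
    by (intro conjunct2[OF uact_Ures[OF assms(1,2)]])
      (auto simp: l fock_lift_def lookup_fock_act)
  then show "Poly_Mapping.lookup (fock_act \<epsilon> (x * y) v) (i, j) = Poly_Mapping.lookup (fock_act \<epsilon> x (fock_act \<epsilon> y v)) (i, j)"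
    using assms(1) by (simp add: lookup_fock_act uact_times)
qed

lemma fock_act_laurent: "u \<in> Ures \<Longrightarrow> uact u (fock_lift v) i j \<in> laurent"
  using uact_Ures[of 1 u "fock_lift v" "fock_lift v"] by (auto simp: fock_lift_def)

lemma fock_act_plus:
  assumes "\<epsilon> \<noteq> 0" "x \<in> Ures" "y \<in> Ures"
  shows "fock_act \<epsilon> (x + y) v = fock_act \<epsilon> x v + fock_act \<epsilon> y v"
  using assms
  by (auto intro!: poly_mapping_eqI
      simp: lookup_fock_act lookup_add uact_plus ev_add fock_act_laurent)

lemma fock_act_add:
  assumes "\<epsilon> \<noteq> 0" "x \<in> Ures"
  shows "fock_act \<epsilon> x (v + w) = fock_act \<epsilon> x v + fock_act \<epsilon> x w"
proof -
  have "fock_lift (v + w) = (\<lambda>i j. fock_lift v i j + fock_lift w i j)"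
    by (simp add: fun_eq_iff fock_lift_def lookup_add const_add)
  then show ?thesis
    using assms
    by (auto intro!: poly_mapping_eqI
        simp: lookup_fock_act lookup_add uact_add ev_add fock_act_laurent)
qed

lemma fock_act_cls:
  assumes "\<epsilon> \<noteq> 0" "x \<in> Ures" "y \<in> Ures" "cls \<epsilon> x = cls \<epsilon> y"
  shows "fock_act \<epsilon> x v = fock_act \<epsilon> y v"
proof -
  obtain u where u: "u \<in> Ures" "x = y + sc (qq - const \<epsilon>) * u"
    using assms cls_eq_iff by blast
  have c: "sc (qq - const \<epsilon>) \<in> Ures" by (intro Ures.scal laurent_diff) auto
  have "fock_act \<epsilon> (sc (qq - const \<epsilon>) * u) v = 0"
    using assms(1) u(1)
    by (auto intro!: poly_mapping_eqI
        simp: lookup_fock_act uact_times uact_sc ev_mult ev_diff fock_act_laurent laurent_diff)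
  then show ?thesis
    using assms u c by (simp add: fock_act_plus Ures.mult)
qed

theorem restricted_fock_exists:
  assumes "\<epsilon> \<noteq> 0"
  shows "\<exists>M. restricted_fock \<epsilon> M"
proof -
  define M :: "(uq set, fock) module" where
    "M = \<lparr>carrier = UNIV, mult = (\<lambda>_ _. 0), one = 0, zero = 0, add = (+),
      smult = (\<lambda>X. fock_act \<epsilon> (SOME u. u \<in> Ures \<and> X = cls \<epsilon> u))\<rparr>"
  have M: "carrier M = UNIV" "zero M = 0" "add M = (+)" by (simp_all add: M_def)
  have sm: "cls \<epsilon> u \<odot>\<^bsub>M\<^esub> v = fock_act \<epsilon> u v" if "u \<in> Ures" for u v
  proof -
    define x where "x = (SOME x. x \<in> Ures \<and> cls \<epsilon> u = cls \<epsilon> x)"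
    have "x \<in> Ures \<and> cls \<epsilon> u = cls \<epsilon> x"
      unfolding x_def by (rule someI[of _ u]) (use that in auto)
    then have "fock_act \<epsilon> x v = fock_act \<epsilon> u v"
      using that by (intro fock_act_cls[OF assms]) auto
    then show ?thesis by (simp add: M_def x_def)
  qed
  have "abelian_group M"
  proof (rule abelian_groupI)
    fix x assume "x \<in> carrier M"
    show "\<exists>y\<in>carrier M. y \<oplus>\<^bsub>M\<^esub> x = \<zero>\<^bsub>M\<^esub>"
      by (rule bexI[of _ "- x"]) (simp_all add: M)
  qed (auto simp: M algebra_simps)
  moreover have "left_module_axioms (Ueps \<epsilon>) M"
  proof
    fix v assume "v \<in> carrier M"
    show "\<one>\<^bsub>Ueps \<epsilon>\<^esub> \<odot>\<^bsub>M\<^esub> v = v"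
      using assms by (auto intro!: poly_mapping_eqI
          simp: one_Ueps sm lookup_fock_act uact_1 fock_lift_def)
  qed (auto simp: carrier_Ueps M cls_add cls_mult sm Ures.add Ures.mult
      fock_act_plus[OF assms] fock_act_add[OF assms] fock_act_times[OF assms])
  ultimately have "left_module (Ueps \<epsilon>) M"
    by (simp add: left_module_def ring_Ueps)
  moreover have "cscale \<epsilon> M z v = fscale z v" for z v
    using assms by (auto intro!: poly_mapping_eqI
        simp: cscale_def sm Ures.scal lookup_fock_act uact_sc ev_mult fock_lift_def)
  moreover have "cls \<epsilon> uK \<odot>\<^bsub>M\<^esub> gvec i j = fscale (\<epsilon> powi (- (i + j + 1))) (gvec i j)"
    if "i \<ge> 0" "j \<ge> 0" for i j
    using assms by (auto intro!: poly_mapping_eqI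
        simp: sm Ures.K lookup_fock_act uact_K ev_mult fock_lift_def lookup_gvec
        simp del: minus_add_distrib)
  moreover have "cls \<epsilon> uKi \<odot>\<^bsub>M\<^esub> gvec i j = fscale (\<epsilon> powi (i + j + 1)) (gvec i j)"
    if "i \<ge> 0" "j \<ge> 0" for i j
    using assms by (auto intro!: poly_mapping_eqI
        simp: sm Ures.Ki lookup_fock_act uact_Ki ev_mult fock_lift_def lookup_gvec)
  moreover have "cls \<epsilon> (divE r) \<odot>\<^bsub>M\<^esub> gvec i j
      = fscale (ev \<epsilon> (qbinom j (j - int r))) (gvec (i - int r) (j - int r))"
    if "i \<ge> 0" "j \<ge> 0" "r \<ge> 1" for i j r
  proof (rule poly_mapping_eqI, clarify)
    fix k l :: nat
    show "Poly_Mapping.lookup (cls \<epsilon> (divE r) \<odot>\<^bsub>M\<^esub> gvec i j) (k, l) =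
      Poly_Mapping.lookup (fscale (ev \<epsilon> (qbinom j (j - int r))) (gvec (i - int r) (j - int r))) (k, l)"
      using assms that
      by (auto simp: sm Ures.E lookup_fock_act uact_divE ev_mult fock_lift_def lookup_gvec)
  qed
  moreover have "cls \<epsilon> (divF r) \<odot>\<^bsub>M\<^esub> gvec i j
      = fscale ((-1) ^ r * ev \<epsilon> (qbinom (int r + i) (int r))) (gvec (i + int r) (j + int r))"
    if "i \<ge> 0" "j \<ge> 0" "r \<ge> 1" for i j r
  proof (rule poly_mapping_eqI, clarify)
    fix k l :: nat
    have s: "(- 1) ^ r = const ((- 1) ^ r)"
      by (cases "even r") (simp_all add: const_uminus)
    show "Poly_Mapping.lookup (cls \<epsilon> (divF r) \<odot>\<^bsub>M\<^esub> gvec i j) (k, l) =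
      Poly_Mapping.lookup (fscale ((-1) ^ r * ev \<epsilon> (qbinom (int r + i) (int r)))
        (gvec (i + int r) (j + int r))) (k, l)"
    proof (cases "int k = i + int r \<and> int l = j + int r")
      case True
      then have "r \<le> k" "r \<le> l" "int (k - r) = i" "int (l - r) = j" "int k = int r + i"
        using that by auto
      then show ?thesis
        using True assms that
        by (simp add: sm Ures.F lookup_fock_act uact_divF s ev_mult laurent_mult
            fock_lift_def lookup_gvec add.commute)
    next
      case False
      then have "\<not> (r \<le> k \<and> r \<le> l \<and> int (k - r) = i \<and> int (l - r) = j)" by auto
      then show ?thesis
        using False assms that
        by (auto simp: sm Ures.F lookup_fock_act uact_divF fock_lift_def lookup_gvec)
    qed
  qed
  ultimately have "restricted_fock \<epsilon> M"
    unfolding restricted_fock_def M by blast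
  then show ?thesis ..
qed

end

theory Submission
  imports Defs
begin

text \<open>
  Write \<open>[n; k]\<close> for \<open>q\<close>-binomials.  With \<open>\<lambda> = -(rp + 1)\<close>, none of the \<open>[\<lambda>; k]\<close> with
  \<open>k \<ge> 0\<close> vanishes at \<open>\<epsilon>\<close>: up to sign \<open>[\<lambda>; k]\<close> is \<open>[rp + k; k]\<close>, and by a Lucas type computation its value is an
  ordinary binomial coefficient, \<open>r + m\<close> over \<open>m\<close>, where \<open>m\<close> is the integral part of \<open>k / p\<close>
  (\<open>ev_qbinom_nonzero\<close>).  This makes the Verma type module of highest weight \<open>\<lambda>\<close> irreducible,
  because \<open>e\<^bsup>(k)\<^esup> f\<^bsup>(k)\<^esup> v = [\<lambda>; k] v\<close> is then a nonzero multiple of the highest weight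
  vector \<open>v\<close> for every \<open>k\<close>.  Consequently there is only one highest weight module of this weight, and
  it remains to see that \<open>V\<^bsup>\<plusminus>rp\<^esup>\<close> is one.

  The argument is carried out with left ideals of the integral form rather than with modules.  The
  annihilator of a highest weight vector is a left ideal containing \<open>q - \<epsilon>\<close>, \<open>e\<close>,
  \<open>e\<^bsup>(p)\<^esup>\<close>, \<open>K - q\<^sup>\<lambda>\<close> and \<open>[K; 0; p] - [\<lambda>; p]\<close> (locale
  \<open>highest_weight_ideal\<close>).  Modulo such an ideal every element of the integral form is a combination
  of the \<open>f\<^bsup>(k)\<^esup>\<close> (\<open>normalizable\<close>), and if such a
  combination lies in a proper ideal of this kind, then its coefficients all vanish at \<open>\<epsilon>\<close>
  (\<open>ev_coeff_eq_0\<close>).  So two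
  nested proper ideals of this kind are equal, and, applying this to their intersection, any two are
  (\<open>highest_weight_ideal_unique\<close>).  The first fact gives irreducibility of the module, the second
  gives the isomorphism \<open>u v \<mapsto> u w\<close> between two modules.

  The computation behind the normal form is the commutation formula for
  \<open>e\<^bsup>(r)\<^esup> f\<^bsup>(s)\<^esup>\<close> (\<open>divE_mult_divFz\<close>).  It also shows that the
  elements \<open>[K; c; t]\<close> lie in the integral form (\<open>kbinom_Ures\<close>), so that the weight condition on
  \<open>[K; 0; p]\<close> makes sense there, and it computes the weight of the lowest basis vector of
  \<open>V\<^bsup>\<plusminus>rp\<^esup>\<close>.  That vector generates because
  \<open>f\<^bsup>(k)\<^esup>\<close> sends it to \<open>[k; k] = 1\<close> or \<open>[rp + k; k]\<close>, up to sign, times the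
  \<open>k\<close>-th basis vector.
\<close>

section \<open>Scalars in the quantum group\<close>

text \<open>
  Multiplication by scalars as an operation of its own: \<open>sc a\<close> is central, but centrality is not a
  terminating rewrite rule, whereas the vector space laws and the two rules moving scalars out of
  products are.
\<close>

definition smul :: "Cq \<Rightarrow> uq \<Rightarrow> uq" (infixr \<open>\<cdot>\<close> 75) where
  "a \<cdot> x = sc a * x"

lemma vector_space_smul: "vector_space smul"
  by unfold_locales (simp_all add: smul_def distrib_left distrib_right sc_add sc_mult sc_1 mult.assoc)

interpretation uq: vector_space smul
  by (rule vector_space_smul)

lemma smul_mult_left [simp]: "(a \<cdot> x) * y = a \<cdot> (x * y)"
  by (simp add: smul_def mult.assoc)

lemma smul_mult_right [simp]: "x * (a \<cdot> y) = a \<cdot> (x * y)"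
  by (simp add: smul_def sc_central flip: mult.assoc)

lemma sc_conv_smul: "sc a = a \<cdot> 1"
  by (simp add: smul_def)

lemma smul_Ures: "a \<in> laurent \<Longrightarrow> x \<in> Ures \<Longrightarrow> a \<cdot> x \<in> Ures"
  by (simp add: smul_def Ures.mult Ures.scal)

lemma Ures_diff: "x \<in> Ures \<Longrightarrow> y \<in> Ures \<Longrightarrow> x - y \<in> Ures"
  using Ures.add[OF _ Ures_uminus, of x y] by simp

lemma Ures_sum: "(\<And>i. i \<in> I \<Longrightarrow> f i \<in> Ures) \<Longrightarrow> sum f I \<in> Ures"
  by (induction I rule: infinite_finite_induct) (auto intro: Ures.add)

section \<open>Identities between \<open>q\<close>-binomials\<close>

lemma qint_minus: "qint (- n) = - qint n"
  by (simp only: qint_def minus_minus flip: minus_divide_left) (simp only: minus_diff_eq minus_divide_left)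

lemma qbinom_Suc: "qbinom n (int (Suc t)) = qbinom n (int t) * qint (n - int t) / qint (int t + 1)"
  by (simp add: qbinom_def nat_add_distrib qfact_Suc add.commute)

lemma qbinom_1 [simp]: "qbinom n 1 = qint n"
  using qbinom_Suc[of n 0] by simp

lemma qint_laurent [simp, intro]: "qint n \<in> laurent"
  using qbinom_laurent[of n 1] by simp

lemma qbinom_self [simp]: "qbinom (int n) (int n) = 1"
  using qbinom_qfact[of n 0] qfact_nonzero[of n] by (simp add: qfact_def del: qfact_nonzero)

lemma qbinom_Suc_mult: "qint (int t + 1) * qbinom n (int (Suc t)) = qbinom n (int t) * qint (n - int t)"
  using qint_nonzero[of "int t + 1"] by (simp add: qbinom_Suc del: of_nat_Suc)

text \<open>
  The common inductive step of \<open>qbinom_split\<close> and of its operator version \<open>kbinom_split\<close>.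
\<close>

lemma qbinom_qfact_Suc:
  "qbinom (int (a + Suc b)) (int a) / qint (int (a + b) + 1) = qbinom (int (a + b)) (int a) / qint (int b + 1)"
  using qint_nonzero[of "int b + 1"] qint_nonzero[of "int (a + b) + 1"]
  by (simp only: qbinom_qfact) (simp add: qfact_Suc add.commute add.left_commute)

lemma qbinom_split:
  "qbinom (int (a + b)) (int a) * qbinom n (int (a + b)) = qbinom n (int a) * qbinom (n - int a) (int b)"
proof (induction b)
  case (Suc b)
  have "qbinom (int (a + Suc b)) (int a) * qbinom n (int (a + Suc b))
      = (qbinom (int (a + Suc b)) (int a) / qint (int (a + b) + 1)) * qbinom n (int (a + b)) * qint (n - int (a + b))"
    using qbinom_Suc[of n "a + b"] by simp
  also have "\<dots> = (qbinom (int (a + b)) (int a) * qbinom n (int (a + b))) * qint (n - int (a + b)) / qint (int b + 1)"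
    unfolding qbinom_qfact_Suc by simp
  also have "\<dots> = qbinom n (int a) * qbinom (n - int a) (int (Suc b))"
    unfolding Suc qbinom_Suc[of "n - int a" b] by (simp add: algebra_simps)
  finally show ?case .
qed simp

text \<open>
  Each of the \<open>k\<close> factors \<open>[-n - 1 - i]\<close> is \<open>- [n + 1 + i]\<close>.
\<close>

lemma qbinom_neg: "qbinom (- (int n + 1)) (int k) = (- 1) ^ k * qbinom (int (n + k)) (int k)"
proof -
  have "qfact n * (\<Prod>i<k. qint (- (int n + 1) - int i)) = (- 1) ^ k * qfact (n + k)"
  proof (induction k)
    case (Suc k)
    have "- (int n + 1) - int k = - int (Suc (n + k))" by simp
    then have "qfact n * (\<Prod>i<Suc k. qint (- (int n + 1) - int i))
        = - (qfact n * (\<Prod>i<k. qint (- (int n + 1) - int i))) * qint (int (Suc (n + k)))"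
      by (simp only: prod.lessThan_Suc qint_minus) simp
    also have "\<dots> = (- 1) ^ Suc k * qfact (n + Suc k)"
      unfolding Suc by (simp add: qfact_Suc)
    finally show ?case .
  qed simp
  then have "(\<Prod>i<k. qint (- (int n + 1) - int i)) = (- 1) ^ k * qfact (n + k) / qfact n"
    by (simp add: field_simps)
  moreover have "qbinom (int (n + k)) (int k) = qfact (n + k) / (qfact k * qfact n)"
    using qbinom_qfact[of k n] by (simp only: add.commute)
  ultimately show ?thesis
    by (simp add: qbinom_def)
qed

section \<open>The elements \<open>[K; c; t]\<close>\<close>

text \<open>
  The element \<open>[K; c]\<close>, which is \<open>[m + c]\<close> on vectors on which \<open>K\<close> is \<open>q\<^sup>m\<close>.
\<close>

definition kint :: "int \<Rightarrow> uq" where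
  "kint c = (qq powi c / (qq - inverse qq)) \<cdot> uK - (qq powi (- c) / (qq - inverse qq)) \<cdot> uKi"

text \<open>
  Lusztig's \<open>[K; c; t]\<close>, which is \<open>[m + c; t]\<close> on vectors on which \<open>K\<close> is \<open>q\<^sup>m\<close>.  The shift
  \<open>c\<close> is present because moving \<open>e\<close> across \<open>[K; c; t]\<close> changes it.
\<close>

primrec kbinom :: "int \<Rightarrow> nat \<Rightarrow> uq" where
  "kbinom c 0 = 1"
| "kbinom c (Suc t) = (1 / qint (int t + 1)) \<cdot> (kbinom c t * kint (c - int t))"

lemma Kbinom_eq_kbinom: "Kbinom t = kbinom 0 t"
proof (induction t)
  case (Suc t)
  have *: "qq powi int (Suc t) - qq powi (- int (Suc t)) = qint (int t + 1) * (qq - inverse qq)"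
    by (simp add: qint_def add.commute)
  have "Kbinom (Suc t) = Kbinom t * (1 / (qq powi int (Suc t) - qq powi (- int (Suc t)))) \<cdot>
      (qq powi (1 - int (Suc t)) \<cdot> uK - qq powi (int (Suc t) - 1) \<cdot> uKi)"
    by (simp add: Kbinom_def smul_def upt_Suc_append mult.assoc del: upt_Suc of_nat_Suc)
  also have "\<dots> = kbinom 0 (Suc t)"
    unfolding Suc * by (simp add: kint_def uq.scale_right_diff_distrib right_diff_distrib)
  finally show ?case .
qed (simp add: Kbinom_def)

lemma kint_commute: "kint a * kint b = kint b * kint a"
  by (simp add: kint_def algebra_simps uq_relations)

lemma kbinom_kint_commute: "kbinom a t * kint b = kint b * kbinom a t"
proof (induction t)
  case (Suc t)
  then show ?case by (simp add: mult.assoc kint_commute[of _ b]) (simp flip: mult.assoc)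
qed simp

text \<open>
  The operator version of \<open>qbinom_split\<close>.  Modulo \<open>q - \<epsilon>\<close> it recovers \<open>[K; c; a + b]\<close> from shorter products as
  long as the \<open>q\<close>-binomial in front does not vanish at \<open>\<epsilon>\<close>.
\<close>

lemma kbinom_split: "qbinom (int (a + b)) (int a) \<cdot> kbinom c (a + b) = kbinom c a * kbinom (c - int a) b"
proof (induction b)
  case (Suc b)
  have "qbinom (int (a + Suc b)) (int a) \<cdot> kbinom c (a + Suc b)
      = (qbinom (int (a + Suc b)) (int a) / qint (int (a + b) + 1)) \<cdot> kbinom c (a + b) * kint (c - int (a + b))"
    by simp
  also have "\<dots> = (1 / qint (int b + 1)) \<cdot> ((qbinom (int (a + b)) (int a) \<cdot> kbinom c (a + b)) * kint (c - int (a + b)))"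
    unfolding qbinom_qfact_Suc by simp
  also have "\<dots> = kbinom c a * kbinom (c - int a) (Suc b)"
    unfolding Suc by (simp add: mult.assoc algebra_simps)
  finally show ?case .
qed simp

lemma kbinom_Suc: "qint (int t + 1) \<cdot> kbinom c (Suc t) = kbinom c t * kint (c - int t)"
  using qint_nonzero[of "int t + 1"] by simp

lemma kbinom_Suc_left: "qint (int t + 1) \<cdot> kbinom (c + 1) (Suc t) = kint (c + 1) * kbinom c t"
  using kbinom_split[of 1 t "c + 1"] qbinom_qfact[of 1 t]
  by (simp add: qfact_Suc add.commute)

text \<open>
  Comparing the coefficients of \<open>K\<close> and of its inverse reduces this to the two ways of
  expanding \<open>[a + t]\<close>.
\<close>

lemma kint_combine:
  "qint a \<cdot> kint (n - a - t) + qint t \<cdot> kint n = qint (a + t) \<cdot> kint (n - a)"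
proof -
  have 1: "qint a * qq powi (n - a - t) + qint t * qq powi n = qint (a + t) * qq powi (n - a)"
  proof -
    have "qq powi n = qq powi a * qq powi (n - a)" "qq powi (n - a - t) = qq powi (- t) * qq powi (n - a)"
      by (simp_all add: algebra_simps flip: power_int_add)
    then show ?thesis using qint_add[of a t] by (simp add: algebra_simps)
  qed
  have 2: "qint a * qq powi (- (n - a - t)) + qint t * qq powi (- n) = qint (a + t) * qq powi (- (n - a))"
  proof -
    have "qq powi (- n) = qq powi (- a) * qq powi (- (n - a))" "qq powi (- (n - a - t)) = qq powi t * qq powi (- (n - a))"
      by (simp_all add: algebra_simps flip: power_int_add)
    then show ?thesis using qint_add[of t a] by (simp add: algebra_simps)
  qed
  let ?d = "qq - inverse qq"
  have "qint a \<cdot> kint (n - a - t) + qint t \<cdot> kint n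
     = ((qint a * qq powi (n - a - t) + qint t * qq powi n) / ?d) \<cdot> uK
       - ((qint a * qq powi (- (n - a - t)) + qint t * qq powi (- n)) / ?d) \<cdot> uKi"
    by (simp only: kint_def uq.scale_right_diff_distrib uq.scale_scale add_divide_distrib uq.scale_left_distrib
       times_divide_eq_right) (simp add: algebra_simps)
  also have "\<dots> = qint (a + t) \<cdot> kint (n - a)"
    unfolding 1 2 by (simp only: kint_def uq.scale_right_diff_distrib uq.scale_scale times_divide_eq_right)
  finally show ?thesis .
qed

text \<open>
  Pascal's rule with \<open>q\<^sup>n\<close> replaced by \<open>q\<^sup>c K\<close>.  It moves statements about \<open>[K; 0; t]\<close> to all
  shifts \<open>c\<close>.
\<close>

lemma kbinom_pascal:
  "kbinom (c + 1) (Suc m) = qq powi (int m + 1) \<cdot> kbinom c (Suc m) + qq powi (int m - c) \<cdot> (uKi * kbinom c m)"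
proof -
  let ?d = "qq - inverse qq" and ?m = "int m + 1"
  have n: "qint ?m \<noteq> 0" by (rule qint_nonzero) simp
  have 1: "qq powi (c + 1) = qq powi ?m * qq powi (c - int m)"
    by (simp add: algebra_simps flip: power_int_add)
  have 2: "qq powi (- (c + 1)) = qq powi (int m - c) * qq powi (- ?m)"
    by (simp add: algebra_simps flip: power_int_add)
  have 3: "qq powi (int m - c) * qint ?m = qq powi (int m - c) * qq powi ?m / ?d - qq powi (int m - c) * qq powi (- ?m) / ?d"
    by (simp only: qint_def diff_divide_distrib right_diff_distrib times_divide_eq_right)
  have 4: "kint (c + 1) = qq powi ?m \<cdot> kint (c - int m) + (qq powi (int m - c) * qint ?m) \<cdot> uKi"
    unfolding kint_def 1 2 3 by (simp add: algebra_simps)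
  have "qint ?m \<cdot> kbinom (c + 1) (Suc m) = qint ?m \<cdot> (qq powi ?m \<cdot> kbinom c (Suc m) + qq powi (int m - c) \<cdot> (uKi * kbinom c m))"
    unfolding kbinom_Suc_left 4 using kbinom_Suc[of m c]
    by (simp add: distrib_right kbinom_kint_commute uq.scale_right_distrib mult.commute[of "qint _"])
      (simp add: n mult.commute mult.left_commute kbinom_kint_commute)
  then show ?thesis using n by simp
qed

section \<open>Moving divided powers of \<open>e\<close> past divided powers of \<open>f\<close>\<close>

lemma divE_0 [simp]: "divE 0 = 1" and divF_0 [simp]: "divF 0 = 1"
  by (simp_all add: divE_def divF_def qfact_def sc_1)

lemma divE_1 [simp]: "divE (Suc 0) = uE" and divF_1 [simp]: "divF (Suc 0) = uF"
  by (simp_all add: divE_def divF_def qfact_def sc_1)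

lemma divE_smul: "divE r = (1 / qfact r) \<cdot> uE ^ r" and divF_smul: "divF r = (1 / qfact r) \<cdot> uF ^ r"
  by (simp_all add: divE_def divF_def smul_def)

lemma divE_mult: "divE a * divE b = qbinom (int (a + b)) (int a) \<cdot> divE (a + b)"
  and divF_mult: "divF a * divF b = qbinom (int (a + b)) (int a) \<cdot> divF (a + b)"
  unfolding qbinom_qfact by (simp_all add: divE_smul divF_smul power_add mult.commute)

lemma E_divE: "uE * divE r = qint (int r + 1) \<cdot> divE (Suc r)"
  using qint_nonzero[of "int r + 1"] by (simp add: divE_smul qfact_Suc add.commute)

lemma divF_Suc: "qint (int n + 1) \<cdot> divF (Suc n) = divF n * uF"
  using qint_nonzero[of "int n + 1"]
  by (simp add: divF_smul qfact_Suc add.commute power_commutes)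

lemma K_mult_E: "uK * uE = qq powi 2 \<cdot> (uE * uK)"
  and K_mult_F: "uK * uF = qq powi (-2) \<cdot> (uF * uK)"
proof -
  have "uK * uE * uKi * uK = qq powi 2 \<cdot> (uE * uK)" "uK * uF * uKi * uK = qq powi (-2) \<cdot> (uF * uK)"
    unfolding uq_relations(3,4) by (simp_all add: smul_def mult.assoc)
  then show "uK * uE = qq powi 2 \<cdot> (uE * uK)" "uK * uF = qq powi (-2) \<cdot> (uF * uK)"
    by (simp_all add: mult.assoc uq_relations)
qed

lemma smul_swap: "x = a \<cdot> y \<Longrightarrow> a \<noteq> 0 \<Longrightarrow> y = inverse a \<cdot> x"
  by simp

lemma Ki_mult_E: "uKi * uE = qq powi (-2) \<cdot> (uE * uKi)"
  and Ki_mult_F: "uKi * uF = qq powi 2 \<cdot> (uF * uKi)"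
proof -
  have "uKi * (uK * uE) * uKi = qq powi 2 \<cdot> (uKi * uE * (uK * uKi))"
    "uKi * (uK * uF) * uKi = qq powi (-2) \<cdot> (uKi * uF * (uK * uKi))"
    by (simp_all add: K_mult_E K_mult_F mult.assoc)
  then have "uE * uKi = qq powi 2 \<cdot> (uKi * uE)" "uF * uKi = qq powi (-2) \<cdot> (uKi * uF)"
    by (simp_all add: uq_relations flip: mult.assoc)
  from this[THEN smul_swap] show "uKi * uE = qq powi (-2) \<cdot> (uE * uKi)" "uKi * uF = qq powi 2 \<cdot> (uF * uKi)"
    by (simp_all add: power_int_minus)
qed

lemma kint_mult_E: "uE * kint c = kint (c - 2) * uE"
  and kint_mult_F: "kint c * uF = uF * kint (c - 2)"
proof -
  have "qq powi c = qq powi (c - 2) * qq powi 2" "qq powi (- c) = qq powi (- (c - 2)) * qq powi (- 2)"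
    "qq powi 2 * qq powi (- 2) = 1" "qq powi c * qq powi (- 2) = qq powi (c - 2)"
     "qq powi (- c) * qq powi 2 = qq powi (- (c - 2))"
    by (simp_all add: algebra_simps del: power_int_numeral flip: power_int_add)
  note q = this
  show "uE * kint c = kint (c - 2) * uE"
    unfolding kint_def q(1,2) by (simp only: left_diff_distrib right_diff_distrib smul_mult_left smul_mult_right K_mult_E Ki_mult_E
       uq.scale_scale times_divide_eq_left)
  show "kint c * uF = uF * kint (c - 2)"
    unfolding kint_def by (simp only: left_diff_distrib right_diff_distrib smul_mult_left smul_mult_right K_mult_F Ki_mult_F
       uq.scale_scale times_divide_eq_left q(4,5))
qed

lemma E_mult_kbinom: "uE * kbinom c t = kbinom (c - 2) t * uE"
proof (induction t)
  case (Suc t)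
  have "uE * kbinom c (Suc t) = (1 / qint (int t + 1)) \<cdot> ((uE * kbinom c t) * kint (c - int t))"
    by (simp add: mult.assoc)
  also have "\<dots> = (1 / qint (int t + 1)) \<cdot> (kbinom (c - 2) t * (uE * kint (c - int t)))"
    unfolding Suc by (simp add: mult.assoc)
  also have "\<dots> = kbinom (c - 2) (Suc t) * uE"
    unfolding kint_mult_E by (simp add: mult.assoc algebra_simps)
  finally show ?case .
qed simp

lemma E_mult_F: "uE * uF = uF * uE + kint 0"
proof -
  have "uE * uF - uF * uE = kint 0"
    by (simp add: uq_relations kint_def smul_def right_diff_distrib)
  then show ?thesis by (simp add: algebra_simps)
qed

lemma E_mult_divF: "uE * divF (Suc n) = divF (Suc n) * uE + divF n * kint (- int n)"
proof (induction n)
  case 0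
  show ?case by (simp add: E_mult_F)
next
  case (Suc n)
  let ?n = "Suc n"
  have "qint (int ?n + 1) \<cdot> (uE * divF (Suc ?n)) = (uE * divF ?n) * uF"
    by (simp only: divF_Suc mult.assoc flip: smul_mult_right)
  also have "\<dots> = divF ?n * (uE * uF) + divF n * (kint (- int n) * uF)"
    unfolding Suc by (simp only: distrib_right mult.assoc)
  also have "\<dots> = divF ?n * uF * uE + divF ?n * kint 0 + divF n * uF * kint (- int n - 2)"
    by (simp add: E_mult_F kint_mult_F distrib_left mult.assoc)
  also have "\<dots> = qint (int ?n + 1) \<cdot> (divF (Suc ?n) * uE)
      + divF ?n * (qint (int ?n) \<cdot> kint (0 - int ?n - 1) + qint 1 \<cdot> kint 0)"
    using divF_Suc[of n] divF_Suc[of ?n]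
    by (simp add: distrib_left add.commute flip: smul_mult_left)
  also have "\<dots> = qint (int ?n + 1) \<cdot> (divF (Suc ?n) * uE + divF ?n * kint (- int ?n))"
    unfolding kint_combine by (simp add: uq.scale_right_distrib)
  finally show ?case
    using qint_nonzero[of "int ?n + 1"] by simp
qed

text \<open>
  Divided powers with integer exponents, zero for negative ones, so that the sum in the commutation
  formula needs no case distinction on which exponent is larger.
\<close>

definition divFz :: "int \<Rightarrow> uq" where
  "divFz s = (if s < 0 then 0 else divF (nat s))"

lemma divFz_int [simp]: "divFz (int s) = divF s"
  by (simp add: divFz_def)

lemma divFz_neg [simp]: "s < 0 \<Longrightarrow> divFz s = 0"
  by (simp add: divFz_def)

lemma E_mult_divFz: "uE * divFz s = divFz s * uE + divFz (s - 1) * kint (1 - s)"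
proof -
  consider "s < 0" | "s = 0" | n where "s = int (Suc n)"
    by (metis linorder_neqE_linordered_idom pos_int_cases Suc_pred')
  then show ?thesis
  proof cases
    case 3
    then show ?thesis using E_mult_divF[of n] by (simp del: of_nat_Suc) (simp add: divFz_def)
  qed (auto simp: divFz_def)
qed

text \<open>
  The commutation formula of Kac and Lusztig, by induction on \<open>r\<close>: multiplying by \<open>e\<close> turns the
  summand of index \<open>t\<close> into one of index \<open>t\<close> and one of index \<open>t + 1\<close>, and the two contributions to a
  given index are merged by \<open>kint_combine\<close>.
\<close>

lemma divE_mult_divFz:
  "divE r * divFz s = (\<Sum>t\<le>r. divFz (s - int t) * kbinom (2 * int t - int r - s) t * divE (r - t))"
proof (induction r)
  case (Suc r)
  define T where "T = (\<lambda>r t. divFz (s - int t) * kbinom (2 * int t - int r - s) t * divE (r - t))"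
  define A where "A = (\<lambda>t. qint (int r + 1 - int t) \<cdot> (divFz (s - int t) * kbinom (2 * int t - int r - s - 2) t * divE (Suc r - t)))"
  define B where "B = (\<lambda>t. divFz (s - int (Suc t)) * kint (int (Suc t) - s) * kbinom (2 * int t - int r - s) t * divE (r - t))"
  have step: "uE * T r t = A t + B t" if "t \<le> r" for t
  proof -
    have "uE * T r t = (uE * divFz (s - int t)) * kbinom (2 * int t - int r - s) t * divE (r - t)"
      by (simp add: T_def mult.assoc)
    also have "\<dots> = divFz (s - int t) * (uE * kbinom (2 * int t - int r - s) t) * divE (r - t) + B t"
      unfolding E_mult_divFz by (simp add: B_def algebra_simps)
    also have "divFz (s - int t) * (uE * kbinom (2 * int t - int r - s) t) * divE (r - t)
       = divFz (s - int t) * kbinom (2 * int t - int r - s - 2) t * (uE * divE (r - t))"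
      unfolding E_mult_kbinom by (simp add: mult.assoc)
    also have "\<dots> = A t"
      using that by (simp add: A_def E_divE Suc_diff_le of_nat_diff algebra_simps)
    finally show ?thesis .
  qed
  \<comment> \<open>The coefficient of \<open>A (r + 1)\<close> is \<open>[0]\<close>, so the first sum may be extended by this term.\<close>
  have last: "A (Suc r) = 0" by (simp add: A_def)
  have AB: "A (Suc t) + B t = qint (int r + 1) \<cdot> T (Suc r) (Suc t)" if "t \<le> r" for t
  proof -
    define c where "c = 2 * int t - int r - s"
    have c: "2 * int (Suc t) - int r - s - 2 = c" "2 * int (Suc t) - int (Suc r) - s = c + 1"
      by (simp_all add: c_def)
    have "qint (int r - int t) \<cdot> kbinom c (Suc t) + kint (int (Suc t) - s) * kbinom c t
        = qint (int r + 1) \<cdot> kbinom (c + 1) (Suc t)"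
    proof -
      let ?N = "int t + 1 - s"
      have n: "qint (int t + 1) \<noteq> 0" by (rule qint_nonzero) simp
      have e: "?N - (int r - int t) - (int t + 1) = c - int t" "?N - (int r - int t) = c + 1"
        by (simp_all add: c_def)
      have "qint (int t + 1) \<cdot> (qint (int r - int t) \<cdot> kbinom c (Suc t) + kint (int (Suc t) - s) * kbinom c t)
          = qint (int r - int t) \<cdot> (qint (int t + 1) \<cdot> kbinom c (Suc t)) + qint (int t + 1) \<cdot> kint ?N * kbinom c t"
        by (simp add: uq.scale_right_distrib mult.commute add.commute del: kbinom.simps)
      also have "\<dots> = (qint (int r - int t) \<cdot> kint (c - int t) + qint (int t + 1) \<cdot> kint ?N) * kbinom c t"
        unfolding kbinom_Suc by (simp add: kbinom_kint_commute distrib_right)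
      also have "\<dots> = qint (int r + 1) \<cdot> (kint (c + 1) * kbinom c t)"
        using kint_combine[of "int r - int t" ?N "int t + 1"] unfolding e by (simp add: add.commute)
      also have "\<dots> = qint (int t + 1) \<cdot> (qint (int r + 1) \<cdot> kbinom (c + 1) (Suc t))"
        unfolding kbinom_Suc_left[symmetric] by (simp add: mult.commute del: kbinom.simps)
      finally show ?thesis by (rule uq.scale_left_imp_eq[OF n])
    qed
    then have "divFz (s - int (Suc t)) * (qint (int r - int t) \<cdot> kbinom c (Suc t) + kint (int (Suc t) - s) * kbinom c t) * divE (r - t)
      = divFz (s - int (Suc t)) * (qint (int r + 1) \<cdot> kbinom (c + 1) (Suc t)) * divE (r - t)"
      by simp
    then show ?thesis
      unfolding A_def B_def T_def c by (simp add: c_def[symmetric] distrib_left distrib_right mult.assoc del: kbinom.simps)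
  qed
  have "qint (int r + 1) \<cdot> (divE (Suc r) * divFz s) = uE * (divE r * divFz s)"
    using E_divE[of r] by (simp flip: mult.assoc smul_mult_left)
  also have "\<dots> = (\<Sum>t\<le>r. A t + B t)"
    unfolding Suc sum_distrib_left using step by (simp add: T_def)
  also have "\<dots> = (\<Sum>t\<le>Suc r. A t) + (\<Sum>t\<le>r. B t)"
    by (simp add: sum.distrib last)
  also have "\<dots> = A 0 + (\<Sum>t\<le>r. A (Suc t) + B t)"
    unfolding sum.atMost_Suc_shift by (simp add: sum.distrib)
  also have "\<dots> = qint (int r + 1) \<cdot> T (Suc r) 0 + (\<Sum>t\<le>r. qint (int r + 1) \<cdot> T (Suc r) (Suc t))"
    using AB by (simp add: A_def T_def)
  also have "\<dots> = qint (int r + 1) \<cdot> (\<Sum>t\<le>Suc r. T (Suc r) t)"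
    unfolding sum.atMost_Suc_shift by (simp add: uq.scale_right_distrib uq.scale_sum_right)
  finally show ?case
    using qint_nonzero[of "int r + 1"] unfolding T_def by simp
qed simp

lemma divE_Ures [simp, intro]: "divE r \<in> Ures" and divF_Ures [simp, intro]: "divF r \<in> Ures"
  using Ures.E[of r] Ures.F[of r] by (cases r; simp)+

lemma divFz_Ures [simp, intro]: "divFz s \<in> Ures"
  by (simp add: divFz_def)

lemma kbinom_shift_Ures:
  assumes "kbinom 0 (Suc m) \<in> Ures" "\<And>c. kbinom c m \<in> Ures"
  shows "kbinom c (Suc m) \<in> Ures"
proof (induction c rule: int_induct[where k = 0])
  case base
  show ?case by (rule assms)
next
  case (step1 i)
  then show ?case unfolding kbinom_pascal
    by (intro Ures.add smul_Ures Ures.mult Ures.Ki assms) auto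
next
  case (step2 i)
  have "qq powi (int m + 1) \<cdot> kbinom (i - 1) (Suc m)
      = kbinom i (Suc m) - qq powi (int m - (i - 1)) \<cdot> (uKi * kbinom (i - 1) m)"
    using kbinom_pascal[of "i - 1" m] by (simp del: kbinom.simps)
  then have "kbinom (i - 1) (Suc m) = qq powi (- (int m + 1)) \<cdot>
      (kbinom i (Suc m) - qq powi (int m - (i - 1)) \<cdot> (uKi * kbinom (i - 1) m))"
    using smul_swap[of _ "qq powi (int m + 1)" "kbinom (i - 1) (Suc m)"] unfolding power_int_minus
    by (metis power_int_eq_0_iff qq_nonzero)
  also have "\<dots> \<in> Ures"
    using step2 by (intro Ures_diff smul_Ures Ures.mult Ures.Ki assms) auto
  finally show ?case .
qed

text \<open>
  The commutation formula for \<open>e\<^bsup>(t)\<^esup> f\<^bsup>(t)\<^esup>\<close> has \<open>[K; 0; t]\<close> as its last summand,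
  and in the other summands only \<open>[K; c; u]\<close> with \<open>u < t\<close> occur.
\<close>

lemma kbinom_Ures: "kbinom c t \<in> Ures"
proof (induction t arbitrary: c rule: less_induct)
  case (less t)
  show ?case
  proof (cases t)
    case (Suc m)
    have "divE t * divF t = (\<Sum>u<t. divFz (int t - int u) * kbinom (2 * int u - int t - int t) u * divE (t - u)) + kbinom 0 t"
      using divE_mult_divFz[of t "int t"] divFz_int[of 0]
      unfolding lessThan_Suc_atMost[symmetric] sum.lessThan_Suc by simp
    then have "kbinom 0 t = divE t * divF t
        - (\<Sum>u<t. divFz (int t - int u) * kbinom (2 * int u - int t - int t) u * divE (t - u))"
      by simp
    also have "\<dots> \<in> Ures"
      by (intro Ures_diff Ures_sum Ures.mult less.IH) auto
    finally have "kbinom 0 (Suc m) \<in> Ures"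
      unfolding Suc .
    then show ?thesis
      unfolding Suc by (rule kbinom_shift_Ures) (rule less.IH, simp add: Suc)
  qed simp
qed

section \<open>Values of \<open>q\<close>-numbers at an odd root of unity\<close>

locale odd_root_of_unity =
  fixes \<epsilon> :: complex and p :: nat
  assumes odd_p: "odd p" and p_gt_1: "1 < p"
    and pow_p: "\<epsilon> ^ p = 1" and primitive: "\<And>k. 0 < k \<Longrightarrow> k < p \<Longrightarrow> \<epsilon> ^ k \<noteq> 1"
begin

lemma eps_nonzero [simp]: "\<epsilon> \<noteq> 0"
  using pow_p p_gt_1 by (auto simp: power_0_left)

lemma eps_powi_eq_1_iff: "\<epsilon> powi n = 1 \<longleftrightarrow> int p dvd n"
proof -
  define k where "k = nat (n mod int p)"
  have k: "n mod int p = int k" "k < p"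
    using p_gt_1 by (simp_all add: k_def nat_less_iff)
  have "\<epsilon> powi n = \<epsilon> powi (int p * (n div int p)) * \<epsilon> powi (n mod int p)"
    by (simp flip: power_int_add)
  also have "\<dots> = \<epsilon> ^ k"
    using pow_p by (simp add: k power_int_mult)
  finally have "\<epsilon> powi n = 1 \<longleftrightarrow> k = 0"
    using primitive[of k] k(2) by auto
  also have "\<dots> \<longleftrightarrow> int p dvd n"
    using k(1) by (auto simp: dvd_eq_mod_eq_0)
  finally show ?thesis .
qed

lemma p_dvd_double_iff: "int p dvd 2 * n \<longleftrightarrow> int p dvd n"
  using odd_p by (intro coprime_dvd_mult_right_iff) (simp add: coprime_int_iff)

lemma eps_powi_eq_minus_iff: "\<epsilon> powi n = \<epsilon> powi (- n) \<longleftrightarrow> int p dvd n"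
proof -
  have "\<epsilon> powi n = \<epsilon> powi (- n) \<longleftrightarrow> \<epsilon> powi (2 * n) = 1"
    by (simp add: power_int_minus power_int_mult power2_eq_square field_simps mult.commute[of 2]
        power_int_mult_distrib del: mult_2)
  then show ?thesis
    by (simp add: eps_powi_eq_1_iff p_dvd_double_iff)
qed

lemma eps_neq_inverse: "\<epsilon> - inverse \<epsilon> \<noteq> 0"
  using eps_powi_eq_minus_iff[of 1] p_gt_1 by (simp add: power_int_minus)

lemma laurent_den: "qq - inverse qq \<in> laurent"
  and ev_den: "ev \<epsilon> (qq - inverse qq) = \<epsilon> - inverse \<epsilon>"
  using laurent_qq_powi[of "-1"] ev_qq_powi[of \<epsilon> "-1"]
  by (auto simp: power_int_minus ev_diff)

lemma ev_qint: "ev \<epsilon> (qint n) = (\<epsilon> powi n - \<epsilon> powi (- n)) / (\<epsilon> - inverse \<epsilon>)"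
proof -
  have "(qq - inverse qq) * qint n = qq powi n - qq powi (- n)"
    by (simp add: qint_def)
  then have "ev \<epsilon> (qq - inverse qq) * ev \<epsilon> (qint n) = \<epsilon> powi n - \<epsilon> powi (- n)"
    by (metis ev_diff ev_mult ev_qq_powi eps_nonzero laurent_den laurent_qq_powi qint_laurent)
  then show ?thesis
    unfolding ev_den using eps_neq_inverse by (metis nonzero_mult_div_cancel_left)
qed

lemma ev_qint_eq_0_iff: "ev \<epsilon> (qint n) = 0 \<longleftrightarrow> int p dvd n"
  using eps_neq_inverse eps_powi_eq_minus_iff[of n] by (simp add: ev_qint)

lemma ev_qint_add_multiple: "ev \<epsilon> (qint (int (r * p) + n)) = ev \<epsilon> (qint n)"
proof -
  have "\<epsilon> powi int (r * p) = 1" "\<epsilon> powi - int (r * p) = 1"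
    unfolding eps_powi_eq_1_iff by simp_all
  then have "\<epsilon> powi (int (r * p) + n) = \<epsilon> powi n" "\<epsilon> powi (- int (r * p) + - n) = \<epsilon> powi (- n)"
    by (simp_all only: power_int_add eps_nonzero simp_thms mult_1)
  then show ?thesis
    by (simp add: ev_qint)
qed

text \<open>
  \<open>[ap] / [p]\<close> is the number \<open>[a]\<close> for the parameter \<open>q\<^sup>p\<close>, whose value at \<open>\<epsilon>\<close> is the
  classical one.
\<close>

lemma qint_multiple:
  obtains d where "d \<in> laurent" "qint (int (a * p)) = qint (int p) * d" "ev \<epsilon> d = of_nat a"
proof -
  have "\<exists>d\<in>laurent. qint (int (a * p)) = qint (int p) * d \<and> ev \<epsilon> d = of_nat a"
  proof (induction a)
    case 0
    then show ?case by (intro bexI[of _ 0]) auto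
  next
    case (Suc a)
    then obtain d where d: "d \<in> laurent" "qint (int (a * p)) = qint (int p) * d" "ev \<epsilon> d = of_nat a"
      by blast
    let ?d = "qq powi int (a * p) + qq powi (- int p) * d"
    have 1: "\<epsilon> powi int (a * p) = 1" "\<epsilon> powi (- int p) = 1"
      unfolding eps_powi_eq_1_iff by simp_all
    have "qint (int (Suc a * p)) = qint (int p) * ?d"
    proof -
      have "int (Suc a * p) = int (a * p) + int p" by simp
      then show ?thesis
        by (simp only: qint_add d(2)) (simp only: distrib_left mult_ac)
    qed
    moreover have "ev \<epsilon> ?d = of_nat (Suc a)"
      using d(1,3) 1 by (simp add: ev_add ev_mult laurent_mult del: of_nat_mult power_int_of_nat)
    ultimately show ?case
      using d(1) by (intro bexI[of _ ?d]) auto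
  qed
  then show ?thesis using that by blast
qed

text \<open>
  Passing from \<open>k\<close> to \<open>k + 1\<close> multiplies the \<open>q\<close>-binomial by \<open>-[rp + k + 1] / [k + 1]\<close>.  If \<open>p\<close> does
  not divide \<open>k + 1\<close>, numerator and denominator have the same nonzero value at \<open>\<epsilon>\<close> up to sign.  If
  \<open>k + 1 = mp\<close>, both vanish at \<open>\<epsilon>\<close>, but after division by \<open>[p]\<close> the quotient takes the value
  \<open>-(r + m) / m\<close>.
\<close>

lemma ev_qbinom_nonzero: "ev \<epsilon> (qbinom (- (int (r * p) + 1)) (int k)) \<noteq> 0"
proof (induction k)
  case (Suc k)
  let ?l = "- (int (r * p) + 1)"
  have rec: "qint (int (Suc k)) * qbinom ?l (int (Suc k)) = - (qbinom ?l (int k) * qint (int (r * p) + int (Suc k)))"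
    using qbinom_Suc_mult[of k ?l] qint_minus[of "int (r * p) + int (Suc k)"]
    by (simp add: algebra_simps)
  show ?case
  proof (cases "int p dvd int (Suc k)")
    case False
    have "ev \<epsilon> (qint (int (Suc k))) * ev \<epsilon> (qbinom ?l (int (Suc k)))
        = - (ev \<epsilon> (qbinom ?l (int k)) * ev \<epsilon> (qint (int (Suc k))))"
      using arg_cong[OF rec, of "ev \<epsilon>"] ev_qint_add_multiple[of r "int (Suc k)"]
      by (simp add: ev_mult ev_uminus laurent_mult del: of_nat_Suc of_nat_mult)
    then show ?thesis
      using Suc False ev_qint_eq_0_iff[of "int (Suc k)"] by auto
  next
    case True
    then obtain m where m: "Suc k = m * p"
      by (metis int_dvd_int_iff dvdE mult.commute)
    obtain d where d: "d \<in> laurent" "qint (int (m * p)) = qint (int p) * d" "ev \<epsilon> d = of_nat m"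
      by (rule qint_multiple)
    obtain d' where d': "d' \<in> laurent" "qint (int ((r + m) * p)) = qint (int p) * d'" "ev \<epsilon> d' = of_nat (r + m)"
      by (rule qint_multiple)
    have "int (r * p) + int (Suc k) = int ((r + m) * p)"
      unfolding m by (simp add: algebra_simps)
    with rec have "qint (int p) * (d * qbinom ?l (int (Suc k))) = qint (int p) * (- (qbinom ?l (int k) * d'))"
      using d(2) d'(2) unfolding m by (simp add: algebra_simps del: of_nat_mult)
    then have "d * qbinom ?l (int (Suc k)) = - (qbinom ?l (int k) * d')"
      using p_gt_1 qint_nonzero[of "int p"] by (metis mult_left_cancel of_nat_0_less_iff less_trans zero_less_one)
    then have "of_nat m * ev \<epsilon> (qbinom ?l (int (Suc k))) = - (ev \<epsilon> (qbinom ?l (int k)) * of_nat (r + m))"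
      by (metis d(1,3) d'(1,3) ev_mult ev_uminus eps_nonzero laurent_mult qbinom_laurent)
    moreover have "m > 0" using m by (cases m) auto
    ultimately show ?thesis
      using Suc by (metis add_is_0 mult_eq_0_iff neg_equal_0_iff_equal not_gr_zero of_nat_eq_0_iff)
  qed
qed simp

lemma ev_qbinom_multiple_add_nonzero: "ev \<epsilon> (qbinom (int (r * p + k)) (int k)) \<noteq> 0"
proof -
  have "qbinom (int (r * p + k)) (int k) = (- 1) ^ k * qbinom (- (int (r * p) + 1)) (int k)"
    unfolding qbinom_neg by (simp flip: mult.assoc power_mult_distrib)
  then show ?thesis
    using ev_qbinom_nonzero[of r k] by (cases "even k") (simp_all add: ev_uminus)
qed

lemma ev_qbinom_p_nonzero: "ev \<epsilon> (qbinom (int (p + b)) (int p)) \<noteq> 0"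
  using ev_qbinom_multiple_add_nonzero[of 1 b] qbinom_qfact[of p b] qbinom_qfact[of b p]
  by (simp add: add.commute mult.commute)

end

section \<open>Left ideals of the integral form\<close>

text \<open>
  Left ideals containing \<open>q - \<epsilon>\<close> correspond to left ideals of the specialized algebra.  Working
  with their preimages in the integral form allows computing in the generic algebra, where
  division by \<open>q\<close>-numbers is possible.
\<close>

locale spec_left_ideal = odd_root_of_unity +
  fixes A :: "uq set"
  assumes subset: "A \<subseteq> Ures" and zero: "0 \<in> A"
    and add: "x \<in> A \<Longrightarrow> y \<in> A \<Longrightarrow> x + y \<in> A"
    and mult: "u \<in> Ures \<Longrightarrow> x \<in> A \<Longrightarrow> u * x \<in> A"
    and spec: "sc (qq - const \<epsilon>) \<in> A"
begin

lemma smul: "a \<in> laurent \<Longrightarrow> x \<in> A \<Longrightarrow> a \<cdot> x \<in> A"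
  by (simp add: smul_def mult Ures.scal)

lemma uminus: "x \<in> A \<Longrightarrow> - x \<in> A"
  using mult[OF Ures_uminus[OF Ures_1], of x] by simp

lemma diff: "x \<in> A \<Longrightarrow> y \<in> A \<Longrightarrow> x - y \<in> A"
  using add[OF _ uminus, of x y] by simp

lemma sum: "(\<And>i. i \<in> I \<Longrightarrow> f i \<in> A) \<Longrightarrow> sum f I \<in> A"
  by (induction I rule: infinite_finite_induct) (auto intro: zero add)

lemma smul_in_of_ev_0:
  assumes "a \<in> laurent" "ev \<epsilon> a = 0" "x \<in> Ures"
  shows "a \<cdot> x \<in> A"
proof -
  obtain b where b: "b \<in> laurent" "a = (qq - const \<epsilon>) * b"
    using ev_eq_0_iff[of \<epsilon> a] assms by auto
  have "a \<cdot> x = b \<cdot> (x * sc (qq - const \<epsilon>))"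
    by (simp add: b sc_conv_smul mult.commute)
  then show ?thesis
    using b(1) assms(3) by (simp add: smul mult spec)
qed

text \<open>
  A scalar with nonzero value at \<open>\<epsilon>\<close> is invertible modulo \<open>q - \<epsilon>\<close>.
\<close>

lemma cancel:
  assumes "b \<cdot> x \<in> A" "b \<in> laurent" "ev \<epsilon> b \<noteq> 0" "x \<in> Ures"
  shows "x \<in> A"
proof -
  let ?c = "const (1 / ev \<epsilon> b)"
  have "ev \<epsilon> (1 - ?c * b) = 0"
    using assms by (simp add: ev_diff ev_mult laurent_mult)
  then have "(1 - ?c * b) \<cdot> x \<in> A"
    using assms by (intro smul_in_of_ev_0) auto
  moreover have "?c \<cdot> b \<cdot> x \<in> A"
    by (rule smul[OF const_laurent assms(1)])
  moreover have "x = (1 - ?c * b) \<cdot> x + ?c \<cdot> b \<cdot> x"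
    by (simp add: uq.scale_left_diff_distrib)
  ultimately show ?thesis
    using add by metis
qed

text \<open>
  If \<open>A\<close> annihilates \<open>v\<close>, then \<open>x - a\<close> lies in \<open>A\<close> when \<open>v\<close> is an eigenvector of \<open>x\<close> with
  eigenvalue \<open>a\<close>; in these terms eigenvalues are multiplied here, and divided in
  \<open>eig_cancel\<close>.
\<close>

lemma eig_mult:
  assumes "x - a \<cdot> 1 \<in> A" "y - b \<cdot> 1 \<in> A" "x \<in> Ures" "b \<in> laurent"
  shows "x * y - (a * b) \<cdot> 1 \<in> A"
proof -
  have "x * (y - b \<cdot> 1) + b \<cdot> (x - a \<cdot> 1) \<in> A"
    using assms by (intro add mult smul)
  then show ?thesis
    by (simp add: right_diff_distrib uq.scale_right_diff_distrib mult.commute)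
qed

lemma eig_cancel:
  assumes "b \<cdot> x - (b * a) \<cdot> 1 \<in> A" "b \<in> laurent" "ev \<epsilon> b \<noteq> 0" "x \<in> Ures" "a \<in> laurent"
  shows "x - a \<cdot> 1 \<in> A"
proof (rule cancel[OF _ assms(2,3)])
  show "b \<cdot> (x - a \<cdot> 1) \<in> A"
    using assms(1) by (simp add: uq.scale_right_diff_distrib)
  show "x - a \<cdot> 1 \<in> Ures"
    by (intro Ures_diff smul_Ures assms Ures_1)
qed

end

text \<open>
  The relations satisfied by a highest weight vector of weight \<open>l\<close>.
\<close>

locale highest_weight_ideal = spec_left_ideal +
  fixes l :: int
  assumes E: "uE \<in> A" and E_p: "divE p \<in> A"
    and K: "uK - sc (qq powi l) \<in> A"
    and K_p: "Kbinom p - sc (qbinom l (int p)) \<in> A"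
begin

lemma Ki: "uKi - qq powi (- l) \<cdot> 1 \<in> A"
proof -
  have "- (qq powi (- l) \<cdot> uKi) * (uK - sc (qq powi l)) \<in> A"
    by (intro mult K Ures_uminus smul_Ures Ures.Ki) auto
  then show ?thesis
    by (simp add: right_diff_distrib uq_relations sc_conv_smul flip: power_int_add)
qed

lemma kint_Ures: "kint c \<in> Ures"
  using kbinom_Ures[of c 1] by simp

lemma kint_eig: "kint c - qint (l + c) \<cdot> 1 \<in> A"
proof (rule eig_cancel[OF _ laurent_den])
  let ?d = "qq - inverse qq"
  have 1: "qq powi c \<cdot> (uK - qq powi l \<cdot> 1) - qq powi (- c) \<cdot> (uKi - qq powi (- l) \<cdot> 1) \<in> A"
    using K Ki by (intro diff[OF smul smul]) (auto simp: sc_conv_smul)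
  have 2: "?d \<cdot> kint c = qq powi c \<cdot> uK - qq powi (- c) \<cdot> uKi"
    by (simp add: kint_def uq.scale_right_diff_distrib)
  have 3: "?d * qint (l + c) = qq powi c * qq powi l - qq powi (- c) * qq powi (- l)"
    by (simp add: qint_def add.commute flip: power_int_add)
  show "?d \<cdot> kint c - (?d * qint (l + c)) \<cdot> 1 \<in> A"
    unfolding 2 3 using 1 by (simp add: algebra_simps)
qed (use eps_neq_inverse ev_den kint_Ures in auto)

text \<open>
  The weight conditions only mention \<open>K\<close> and \<open>[K; 0; p]\<close>.  They determine the eigenvalue of
  every \<open>[K; c; t]\<close>: for \<open>t < p\<close> because \<open>[K; c; t]\<close> is \<open>[K; c] \<dots> [K; c - t + 1]\<close> divided by
  the \<open>q\<close>-factorial of \<open>t\<close>, which does not vanish at \<open>\<epsilon>\<close>; for \<open>t = p\<close> by Pascal's rule,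
  starting at \<open>c = 0\<close>; and for \<open>t = p + b\<close> by splitting off \<open>[K; c; p]\<close>.
\<close>

lemma kbinom_eig_less: "t < p \<Longrightarrow> kbinom c t - qbinom (l + c) (int t) \<cdot> 1 \<in> A"
proof (induction t)
  case (Suc t)
  then have "kbinom c t * kint (c - int t) - (qbinom (l + c) (int t) * qint (l + (c - int t))) \<cdot> 1 \<in> A"
    by (intro eig_mult kint_eig kbinom_Ures) auto
  then have "qint (int t + 1) \<cdot> kbinom c (Suc t) - (qint (int t + 1) * qbinom (l + c) (int (Suc t))) \<cdot> 1 \<in> A"
    unfolding kbinom_Suc qbinom_Suc_mult by (simp add: algebra_simps)
  moreover have "ev \<epsilon> (qint (int t + 1)) \<noteq> 0"
    using Suc.prems unfolding ev_qint_eq_0_iff by (metis of_nat_Suc add.commute int_dvd_int_iff nat_dvd_not_less zero_less_Suc)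
  ultimately show ?case
    by (rule eig_cancel[OF _ qint_laurent _ kbinom_Ures qbinom_laurent])
qed (simp add: zero)

lemma kbinom_eig_p: "kbinom c p - qbinom (l + c) (int p) \<cdot> 1 \<in> A"
proof -
  obtain m where m: "p = Suc m" using p_gt_1 by (cases p) auto
  \<comment> \<open>The second term of Pascal's rule involves only \<open>[K; i; p - 1]\<close>, which is already known.\<close>
  have low: "qq powi (int m - i) \<cdot> (uKi * kbinom i m) - (qq powi (int m - (l + i)) * qbinom (l + i) (int m)) \<cdot> 1 \<in> A" for i
  proof -
    have "qq powi (int m - i) \<cdot> (uKi * kbinom i m - (qq powi (- l) * qbinom (l + i) (int m)) \<cdot> 1) \<in> A"
      by (intro smul eig_mult Ki kbinom_eig_less Ures.Ki) (auto simp: m)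
    moreover have "qq powi (int m - (l + i)) = qq powi (int m - i) * qq powi (- l)"
      by (simp add: algebra_simps flip: power_int_add)
    ultimately show ?thesis
      by (simp add: uq.scale_right_diff_distrib mult.assoc)
  qed
  have pascal: "(kbinom (i + 1) p - qbinom (l + (i + 1)) (int p) \<cdot> 1)
      = qq powi (int m + 1) \<cdot> (kbinom i p - qbinom (l + i) (int p) \<cdot> 1)
      + (qq powi (int m - i) \<cdot> (uKi * kbinom i m) - (qq powi (int m - (l + i)) * qbinom (l + i) (int m)) \<cdot> 1)" for i
    using kbinom_pascal[of i m] qbinom_pascal[of "l + i" m]
    by (simp add: m uq.scale_right_diff_distrib uq.scale_left_distrib add.assoc del: kbinom.simps of_nat_Suc)
  show ?thesis
  proof (induction c rule: int_induct[where k = 0])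
    case base
    then show ?case using K_p by (simp add: Kbinom_eq_kbinom sc_conv_smul)
  next
    case (step1 i)
    then show ?case unfolding pascal by (intro add smul low) auto
  next
    case (step2 i)
    have "qq powi (int m + 1) \<cdot> (kbinom (i - 1) p - qbinom (l + (i - 1)) (int p) \<cdot> 1) \<in> A"
      using diff[OF step2(2) low[of "i - 1"]] pascal[of "i - 1"] by simp
    then show ?case
      by (rule cancel) (auto intro!: Ures_diff kbinom_Ures smul_Ures)
  qed
qed

lemma kbinom_eig: "kbinom c t - qbinom (l + c) (int t) \<cdot> 1 \<in> A"
proof (induction t arbitrary: c rule: less_induct)
  case (less t)
  show ?case
  proof (cases "t < p")
    case False
    define b where "b = t - p"
    have b: "t = p + b" using False by (simp add: b_def)
    have "kbinom c p * kbinom (c - int p) b - (qbinom (l + c) (int p) * qbinom (l + (c - int p)) (int b)) \<cdot> 1 \<in> A"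
      using p_gt_1 b by (intro eig_mult kbinom_eig_p less.IH kbinom_Ures) auto
    then have "qbinom (int (p + b)) (int p) \<cdot> kbinom c (p + b)
        - (qbinom (int (p + b)) (int p) * qbinom (l + c) (int (p + b))) \<cdot> 1 \<in> A"
      unfolding kbinom_split qbinom_split by (simp add: algebra_simps)
    then show ?thesis
      unfolding b by (rule eig_cancel) (use ev_qbinom_p_nonzero kbinom_Ures in auto)
  qed (rule kbinom_eig_less)
qed

text \<open>
  As for \<open>[K; c; t]\<close>: for \<open>0 < k < p\<close> the divided power \<open>e\<^bsup>(k)\<^esup>\<close> is \<open>e\<^sup>k\<close> divided
  by a \<open>q\<close>-factorial that does not vanish at \<open>\<epsilon>\<close>, and
  \<open>e\<^bsup>(p+b)\<^esup>\<close> is a multiple of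
  \<open>e\<^bsup>(p)\<^esup> e\<^bsup>(b)\<^esup>\<close> modulo \<open>q - \<epsilon>\<close>.
\<close>

lemma divE_mem: "k > 0 \<Longrightarrow> divE k \<in> A"
proof (induction k rule: less_induct)
  case (less k)
  consider "k = 1" | j where "k = Suc j" "j > 0" "k < p" | "k = p" | b where "k = p + b" "b > 0"
    by (metis One_nat_def Suc_pred bot_nat_0.not_eq_extremum less.prems less_imp_add_positive linorder_neqE_nat)
  then show ?case
  proof cases
    case 2
    have "uE * divE j \<in> A"
      using less.IH[of j] 2 mult[OF subset[THEN subsetD, OF E]] by auto
    moreover have "ev \<epsilon> (qint (int j + 1)) \<noteq> 0"
      using 2 unfolding ev_qint_eq_0_iff by (metis of_nat_Suc add.commute int_dvd_int_iff nat_dvd_not_less zero_less_Suc)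
    ultimately show ?thesis
      unfolding E_divE 2(1) by (rule cancel[OF _ qint_laurent _ divE_Ures])
  next
    case 4
    have "divE p * divE b \<in> A"
      using less.IH[of b] 4 p_gt_1 by (intro mult) auto
    then show ?thesis
      unfolding divE_mult 4(1) by (rule cancel[OF _ qbinom_laurent ev_qbinom_p_nonzero divE_Ures])
  qed (use E E_p in auto)
qed

text \<open>
  Only the summand without \<open>e\<close> of the commutation formula survives modulo \<open>A\<close>.
\<close>

lemma divE_divFz: "divE r * divFz s - qbinom (l + int r - s) (int r) \<cdot> divFz (s - int r) \<in> A"
proof -
  have "(\<Sum>t<r. divFz (s - int t) * kbinom (2 * int t - int r - s) t * divE (r - t)) \<in> A"
    by (intro sum mult Ures.mult kbinom_Ures divE_mem) auto
  moreover have "divFz (s - int r) * (kbinom (int r - s) r - qbinom (l + (int r - s)) (int r) \<cdot> 1) \<in> A"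
    by (intro mult kbinom_eig) auto
  ultimately have "(\<Sum>t<r. divFz (s - int t) * kbinom (2 * int t - int r - s) t * divE (r - t))
      + divFz (s - int r) * (kbinom (int r - s) r - qbinom (l + (int r - s)) (int r) \<cdot> 1) \<in> A"
    by (rule add)
  then show ?thesis
    unfolding divE_mult_divFz lessThan_Suc_atMost[symmetric] sum.lessThan_Suc
    by (simp add: right_diff_distrib algebra_simps)
qed

end

section \<open>Normal forms and maximality of highest weight ideals\<close>

lemma divF_commute:
  assumes "x * uF = a \<cdot> (uF * x)"
  shows "x * divF k = a ^ k \<cdot> (divF k * x)"
proof -
  have "x * uF ^ k = a ^ k \<cdot> (uF ^ k * x)"
  proof (induction k)
    case (Suc k)
    have "x * uF ^ Suc k = (x * uF) * uF ^ k"
      by (simp add: mult.assoc)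
    also have "\<dots> = a ^ Suc k \<cdot> (uF ^ Suc k * x)"
      by (simp add: assms Suc mult.assoc)
    finally show ?case .
  qed simp
  then show ?thesis by (simp add: divF_smul mult.commute)
qed

context highest_weight_ideal
begin

text \<open>
  If \<open>v\<close> is a vector annihilated by \<open>A\<close>, a normalizable element maps \<open>v\<close> into the span of the
  vectors \<open>f\<^bsup>(k)\<^esup> v\<close>.
\<close>

definition normalizable :: "uq \<Rightarrow> bool" where
  "normalizable x \<longleftrightarrow> (\<exists>n a. (\<forall>k. a k \<in> laurent) \<and> x - (\<Sum>k<n. a k \<cdot> divF k) \<in> A)"

lemma normalizable_mem: "x \<in> A \<Longrightarrow> normalizable x"
  unfolding normalizable_def by (intro exI[of _ 0] exI[of _ "\<lambda>_. 0"]) auto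

lemma normalizable_add:
  assumes "normalizable x" "normalizable y"
  shows "normalizable (x + y)"
proof -
  obtain n a where a: "\<And>k. a k \<in> laurent" "x - (\<Sum>k<n. a k \<cdot> divF k) \<in> A"
    using assms by (auto simp: normalizable_def)
  obtain m b where b: "\<And>k. b k \<in> laurent" "y - (\<Sum>k<m. b k \<cdot> divF k) \<in> A"
    using assms by (auto simp: normalizable_def)
  define c where "c k = (if k < n then a k else 0) + (if k < m then b k else 0)" for k
  have pad: "(\<Sum>k<i. d k \<cdot> divF k) = (\<Sum>k<max n m. (if k < i then d k else 0) \<cdot> divF k)"
    if "i \<le> max n m" for i d
    using that by (intro sum.mono_neutral_cong_left) auto
  have "(\<Sum>k<n. a k \<cdot> divF k) + (\<Sum>k<m. b k \<cdot> divF k) = (\<Sum>k<max n m. c k \<cdot> divF k)"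
    unfolding c_def pad[of n a, OF max.cobounded1] pad[of m b, OF max.cobounded2]
    by (simp add: uq.scale_left_distrib sum.distrib)
  then have "x + y - (\<Sum>k<max n m. c k \<cdot> divF k) \<in> A"
    using add[OF a(2) b(2)] by (metis add_diff_add)
  moreover have "\<forall>k. c k \<in> laurent"
    using a(1) b(1) by (auto simp: c_def)
  ultimately show ?thesis
    unfolding normalizable_def by blast
qed

lemma normalizable_smul:
  assumes "c \<in> laurent" "normalizable x"
  shows "normalizable (c \<cdot> x)"
proof -
  obtain n a where a: "\<And>k. a k \<in> laurent" "x - (\<Sum>k<n. a k \<cdot> divF k) \<in> A"
    using assms by (auto simp: normalizable_def)
  have "c \<cdot> x - (\<Sum>k<n. (c * a k) \<cdot> divF k) \<in> A"
    using smul[OF assms(1) a(2)] by (simp add: uq.scale_right_diff_distrib uq.scale_sum_right)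
  then show ?thesis
    using assms(1) a(1) unfolding normalizable_def by (intro exI[of _ n] exI[of _ "\<lambda>k. c * a k"]) auto
qed

lemma normalizable_cong: "x - y \<in> A \<Longrightarrow> normalizable y \<Longrightarrow> normalizable x"
  using normalizable_add[OF normalizable_mem, of "x - y" y] by simp

lemma normalizable_sum: "(\<And>i. i \<in> I \<Longrightarrow> normalizable (f i)) \<Longrightarrow> normalizable (sum f I)"
  by (induction I rule: infinite_finite_induct) (auto intro: normalizable_add normalizable_mem zero)

lemma normalizable_divF: "normalizable (divF k)"
proof -
  have "(\<Sum>i<Suc k. (if i = k then 1 else 0) \<cdot> divF i) = (\<Sum>i<Suc k. if i = k then divF i else 0)"
    by (intro sum.cong) auto
  also have "\<dots> = divF k"
    by simp
  finally show ?thesis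
    unfolding normalizable_def
    by (intro exI[of _ "Suc k"] exI[of _ "\<lambda>i. if i = k then 1 else 0"]) (simp add: zero del: sum.lessThan_Suc)
qed

lemma normalizable_divFz: "normalizable (divFz s)"
  using normalizable_divF normalizable_mem[OF zero] by (simp add: divFz_def)

lemma normalizable_multI:
  assumes "u \<in> Ures" "normalizable w" "\<And>k. normalizable (u * divF k)"
  shows "normalizable (u * w)"
proof -
  obtain n a where a: "\<And>k. a k \<in> laurent" "w - (\<Sum>k<n. a k \<cdot> divF k) \<in> A"
    using assms by (auto simp: normalizable_def)
  have "u * w - (\<Sum>k<n. a k \<cdot> (u * divF k)) \<in> A"
    using mult[OF assms(1) a(2)] by (simp add: right_diff_distrib sum_distrib_left)
  then show ?thesis
    by (rule normalizable_cong) (intro normalizable_sum normalizable_smul a assms)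
qed

lemma normalizable_commute:
  assumes "x * uF = a \<cdot> (uF * x)" "x - b \<cdot> 1 \<in> A" "a \<in> laurent" "b \<in> laurent"
  shows "normalizable (x * divF k)"
proof -
  have ak: "a ^ k \<in> laurent"
    using assms(3) by (induction k) auto
  have "a ^ k \<cdot> (divF k * (x - b \<cdot> 1)) \<in> A"
    using assms ak by (intro smul mult) auto
  then have "x * divF k - (a ^ k * b) \<cdot> divF k \<in> A"
    unfolding divF_commute[OF assms(1)] by (simp add: right_diff_distrib uq.scale_right_diff_distrib)
  then show ?thesis
    by (rule normalizable_cong) (intro normalizable_smul normalizable_divF laurent_mult ak assms(4))
qed

lemma normalizable_K: "normalizable (uK * divF k)" and normalizable_Ki: "normalizable (uKi * divF k)"
proof -
  show "normalizable (uK * divF k)"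
    by (rule normalizable_commute[OF K_mult_F K[unfolded sc_conv_smul] laurent_qq_powi laurent_qq_powi])
  show "normalizable (uKi * divF k)"
    by (rule normalizable_commute[OF Ki_mult_F Ki laurent_qq_powi laurent_qq_powi])
qed

lemma normalizable_divE: "normalizable (divE r * divF k)"
  using divE_divFz[of r "int k"] unfolding divFz_int
  by (rule normalizable_cong) (intro normalizable_smul normalizable_divFz qbinom_laurent)

text \<open>
  Modulo \<open>A\<close>, the elements \<open>K\<close> and its inverse multiply each \<open>f\<^bsup>(k)\<^esup>\<close> by a scalar, while divided
  powers of \<open>e\<close> and \<open>f\<close> turn it into a multiple of another divided power of \<open>f\<close> or into \<open>0\<close>.
\<close>

lemma normalizable_mult: "u \<in> Ures \<Longrightarrow> normalizable w \<Longrightarrow> normalizable (u * w)"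
proof (induction u arbitrary: w rule: Ures.induct)
  case (scal a)
  then show ?case using normalizable_smul[of a w] by (simp add: smul_def)
next
  case K
  then show ?case by (rule normalizable_multI[OF Ures.K _ normalizable_K])
next
  case Ki
  then show ?case by (rule normalizable_multI[OF Ures.Ki _ normalizable_Ki])
next
  case (E r)
  show ?case by (rule normalizable_multI[OF divE_Ures E.prems normalizable_divE])
next
  case (F r)
  have "normalizable (divF r * divF k)" for k
    unfolding divF_mult by (intro normalizable_smul normalizable_divF) auto
  then show ?case
    by (rule normalizable_multI[OF divF_Ures F.prems])
next
  case (add x y)
  then show ?case by (simp add: distrib_right normalizable_add)
next
  case (mult x y)
  then show ?case by (simp add: mult.assoc)
qed

lemma normalizable: "u \<in> Ures \<Longrightarrow> normalizable u"
  using normalizable_mult[OF _ normalizable_divF[of 0], of u] by simp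

text \<open>
  Applying \<open>e\<^bsup>(n)\<^esup>\<close>, where \<open>n\<close> is the largest index, kills the lower terms and turns the top
  term into \<open>a\<^sub>n [l; n]\<close>.  If \<open>a\<^sub>n\<close> did not vanish at \<open>\<epsilon>\<close>, then \<open>1\<close> would lie in \<open>A\<close>.
\<close>

lemma ev_coeff_eq_0:
  assumes nz: "\<And>k. ev \<epsilon> (qbinom l (int k)) \<noteq> 0" and "1 \<notin> A"
    and a: "\<And>k. a k \<in> laurent" and "(\<Sum>k<n. a k \<cdot> divF k) \<in> A" "k < n"
  shows "ev \<epsilon> (a k) = 0"
  using assms(4,5)
proof (induction n arbitrary: k)
  case (Suc n)
  have "divE n * (\<Sum>k<Suc n. a k \<cdot> divF k) \<in> A"
    using Suc.prems by (intro mult) auto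
  moreover have "(\<Sum>k<n. a k \<cdot> (divE n * divF k)) \<in> A"
  proof (intro sum smul a)
    fix k assume "k \<in> {..<n}"
    then show "divE n * divF k \<in> A"
      using divE_divFz[of n "int k"] by simp
  qed
  moreover have "a n \<cdot> (divE n * divF n - qbinom l (int n) \<cdot> 1) \<in> A"
    using divE_divFz[of n "int n"] divFz_int[of 0] by (intro smul a) simp
  ultimately have "divE n * (\<Sum>k<Suc n. a k \<cdot> divF k) - (\<Sum>k<n. a k \<cdot> (divE n * divF k))
      - a n \<cdot> (divE n * divF n - qbinom l (int n) \<cdot> 1) \<in> A"
    by (intro diff)
  then have "(a n * qbinom l (int n)) \<cdot> 1 \<in> A"
    by (simp add: distrib_left sum_distrib_left uq.scale_right_diff_distrib)
  then have n: "ev \<epsilon> (a n) = 0"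
    using cancel[of "a n * qbinom l (int n)" 1] \<open>1 \<notin> A\<close> nz a by (auto simp: ev_mult laurent_mult)
  then have "a n \<cdot> divF n \<in> A"
    using a by (intro smul_in_of_ev_0) auto
  then have "(\<Sum>k<n. a k \<cdot> divF k) \<in> A"
    using diff[OF Suc.prems(1)] by fastforce
  then show ?case
    using Suc.IH n Suc.prems(2) less_Suc_eq by blast
qed simp

end

context odd_root_of_unity
begin

text \<open>
  The normal form modulo \<open>A\<close> of an element of \<open>B\<close> again lies in \<open>B\<close>, so its coefficients vanish
  at \<open>\<epsilon>\<close> and it lies in \<open>A\<close>.
\<close>

lemma highest_weight_ideal_subset_imp_eq:
  assumes nz: "\<And>k. ev \<epsilon> (qbinom l (int k)) \<noteq> 0"
    and "highest_weight_ideal \<epsilon> p A l" "highest_weight_ideal \<epsilon> p B l" "A \<subseteq> B" "1 \<notin> B"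
  shows "A = B"
proof -
  interpret A: highest_weight_ideal \<epsilon> p A l by fact
  interpret B: highest_weight_ideal \<epsilon> p B l by fact
  have "u \<in> A" if "u \<in> B" for u
  proof -
    obtain n a where a: "\<And>k. a k \<in> laurent" and red: "u - (\<Sum>k<n. a k \<cdot> divF k) \<in> A"
      using A.normalizable[OF B.subset[THEN subsetD, OF \<open>u \<in> B\<close>]] unfolding A.normalizable_def by blast
    then have "(\<Sum>k<n. a k \<cdot> divF k) \<in> B"
      using B.diff[OF that, of "u - (\<Sum>k<n. a k \<cdot> divF k)"] assms(4) by auto
    then have "ev \<epsilon> (a k) = 0" if "k < n" for k
      using B.ev_coeff_eq_0[of a n k] nz assms(5) a that by blast
    then have "(\<Sum>k<n. a k \<cdot> divF k) \<in> A"
      using a by (intro A.sum A.smul_in_of_ev_0) auto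
    then show ?thesis
      using A.add[OF red] by fastforce
  qed
  with assms(4) show ?thesis by blast
qed

lemma highest_weight_ideal_unique:
  assumes nz: "\<And>k. ev \<epsilon> (qbinom l (int k)) \<noteq> 0"
    and "highest_weight_ideal \<epsilon> p A l" "highest_weight_ideal \<epsilon> p B l" "1 \<notin> A" "1 \<notin> B"
  shows "A = B"
proof -
  interpret A: highest_weight_ideal \<epsilon> p A l by fact
  interpret B: highest_weight_ideal \<epsilon> p B l by fact
  have "highest_weight_ideal \<epsilon> p (A \<inter> B) l"
    by unfold_locales
      (use A.subset in \<open>auto intro: A.zero B.zero A.add B.add A.mult B.mult A.spec B.spec A.E B.E
        A.E_p B.E_p A.K B.K A.K_p B.K_p\<close>)
  from highest_weight_ideal_subset_imp_eq[OF nz this] have "A \<inter> B = A" "A \<inter> B = B"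
    using assms(2-5) by blast+
  then show ?thesis by blast
qed

end

section \<open>Highest weight modules\<close>

text \<open>
  Elements of the specialized algebra are cosets; \<open>act\<close> lets their representatives in the
  integral form act directly.
\<close>

locale Ueps_module = left_module "Ueps \<epsilon>" M for \<epsilon> and M :: "(uq set, 'b) module" +
  assumes eps_nonzero: "\<epsilon> \<noteq> 0"
begin

definition act :: "uq \<Rightarrow> 'b \<Rightarrow> 'b" where
  "act u x = cls \<epsilon> u \<odot>\<^bsub>M\<^esub> x"

lemma act_closed: "u \<in> Ures \<Longrightarrow> x \<in> carrier M \<Longrightarrow> act u x \<in> carrier M"
  by (simp add: act_def smult_closed carrier_Ueps)

lemma act_plus: "u \<in> Ures \<Longrightarrow> w \<in> Ures \<Longrightarrow> x \<in> carrier M \<Longrightarrow> act (u + w) x = act u x \<oplus>\<^bsub>M\<^esub> act w x"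
  using smult_l_distr[of "cls \<epsilon> u" "cls \<epsilon> w" x] by (simp add: act_def carrier_Ueps cls_add)

lemma act_times: "u \<in> Ures \<Longrightarrow> w \<in> Ures \<Longrightarrow> x \<in> carrier M \<Longrightarrow> act (u * w) x = act u (act w x)"
  using smult_assoc[of "cls \<epsilon> u" "cls \<epsilon> w" x] by (simp add: act_def carrier_Ueps cls_mult)

lemma act_add: "u \<in> Ures \<Longrightarrow> x \<in> carrier M \<Longrightarrow> y \<in> carrier M \<Longrightarrow> act u (x \<oplus>\<^bsub>M\<^esub> y) = act u x \<oplus>\<^bsub>M\<^esub> act u y"
  by (simp add: act_def smult_r_distr carrier_Ueps)

lemma act_1: "x \<in> carrier M \<Longrightarrow> act 1 x = x"
  using smult_one[of x] by (simp add: act_def one_Ueps)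

lemma act_0: "x \<in> carrier M \<Longrightarrow> act 0 x = \<zero>\<^bsub>M\<^esub>"
  using act_plus[of 0 0 x] act_closed[of 0 x] by simp

lemma act_zero: "u \<in> Ures \<Longrightarrow> act u \<zero>\<^bsub>M\<^esub> = \<zero>\<^bsub>M\<^esub>"
  using act_add[of u "\<zero>\<^bsub>M\<^esub>" "\<zero>\<^bsub>M\<^esub>"] act_closed[of u "\<zero>\<^bsub>M\<^esub>"] by simp

lemma act_cong:
  assumes "u \<in> Ures" "w \<in> Ures" "u = w + sc (qq - const \<epsilon>) * z" "z \<in> Ures"
  shows "act u x = act w x"
  using assms cls_eq_iff by (metis act_def)

lemma act_laurent:
  assumes "a \<in> laurent"
  shows "act (sc a) x = cscale \<epsilon> M (ev \<epsilon> a) x"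
proof -
  have "ev \<epsilon> (a - const (ev \<epsilon> a)) = 0"
    using assms eps_nonzero by (simp add: ev_diff)
  then obtain b where b: "b \<in> laurent" "a - const (ev \<epsilon> a) = (qq - const \<epsilon>) * b"
    using ev_eq_0_iff[OF eps_nonzero, of "a - const (ev \<epsilon> a)"] assms by auto
  then have "sc a = sc (const (ev \<epsilon> a)) + sc (qq - const \<epsilon>) * sc b"
    by (metis sc_add sc_mult diff_add_cancel add.commute)
  then have "act (sc a) x = act (sc (const (ev \<epsilon> a))) x"
    by (rule act_cong[rotated 2]) (use assms b in \<open>auto intro: Ures.scal\<close>)
  then show ?thesis
    by (simp add: act_def cscale_def)
qed

lemma act_diff_eq_0_iff:
  assumes "u \<in> Ures" "w \<in> Ures" "x \<in> carrier M"
  shows "act (u - w) x = \<zero>\<^bsub>M\<^esub> \<longleftrightarrow> act u x = act w x"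
proof -
  have "act u x = act (u - w) x \<oplus>\<^bsub>M\<^esub> act w x"
    using act_plus[of "u - w" w x] assms by (simp add: Ures_diff)
  moreover have "act (u - w) x \<in> carrier M" "act w x \<in> carrier M"
    using assms by (auto intro: act_closed Ures_diff)
  ultimately show ?thesis
    by (metis M.add.r_cancel_one M.l_zero)
qed

end

locale module_at_root = odd_root_of_unity \<epsilon> p + M: Ueps_module \<epsilon> M
  for \<epsilon> :: complex and p :: nat and M :: "(uq set, 'b) module"
begin

text \<open>
  For \<open>H = 0\<close> this is the annihilator of \<open>v\<close>; a larger \<open>H\<close> occurs in the proof of irreducibility.
\<close>

lemma spec_left_ideal_vimage:
  assumes "v \<in> carrier M" "H \<subseteq> carrier M" "\<zero>\<^bsub>M\<^esub> \<in> H"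
    and "\<And>x y. x \<in> H \<Longrightarrow> y \<in> H \<Longrightarrow> x \<oplus>\<^bsub>M\<^esub> y \<in> H"
    and "\<And>u x. u \<in> Ures \<Longrightarrow> x \<in> H \<Longrightarrow> M.act u x \<in> H"
  shows "spec_left_ideal \<epsilon> p {u \<in> Ures. M.act u v \<in> H}"
proof unfold_locales
  have q: "sc (qq - const \<epsilon>) \<in> Ures"
    by (intro Ures.scal laurent_diff) auto
  have "M.act (sc (qq - const \<epsilon>)) v = M.act 0 v"
    by (rule M.act_cong[of _ _ 1]) (use q in auto)
  then show "sc (qq - const \<epsilon>) \<in> {u \<in> Ures. M.act u v \<in> H}"
    using assms q by (simp add: M.act_0)
qed (use assms in \<open>auto simp: M.act_0 M.act_plus M.act_times intro: Ures.add Ures.mult\<close>)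

lemma highest_weight_ideal_vimage:
  assumes v: "v \<in> weight_space \<epsilon> p M l"
    and e: "cls \<epsilon> uE \<odot>\<^bsub>M\<^esub> v = \<zero>\<^bsub>M\<^esub>" "cls \<epsilon> (divE p) \<odot>\<^bsub>M\<^esub> v = \<zero>\<^bsub>M\<^esub>"
    and H: "H \<subseteq> carrier M" "\<zero>\<^bsub>M\<^esub> \<in> H"
    "\<And>x y. x \<in> H \<Longrightarrow> y \<in> H \<Longrightarrow> x \<oplus>\<^bsub>M\<^esub> y \<in> H"
    "\<And>u x. u \<in> Ures \<Longrightarrow> x \<in> H \<Longrightarrow> M.act u x \<in> H"
  shows "highest_weight_ideal \<epsilon> p {u \<in> Ures. M.act u v \<in> H} l"
proof -
  have vM: "v \<in> carrier M"
    and K: "M.act uK v = M.act (sc (qq powi l)) v"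
    and Kp: "M.act (Kbinom p) v = M.act (sc (qbinom l (int p))) v"
    using v by (auto simp: weight_space_def M.act_laurent) (simp_all add: M.act_def)
  interpret spec_left_ideal \<epsilon> p "{u \<in> Ures. M.act u v \<in> H}"
    by (rule spec_left_ideal_vimage[OF vM H])
  have uE: "uE \<in> Ures"
    using divE_Ures[of 1] by simp
  have Kp': "Kbinom p \<in> Ures"
    by (simp add: Kbinom_eq_kbinom kbinom_Ures)
  show ?thesis
  proof unfold_locales
    show "uK - sc (qq powi l) \<in> {u \<in> Ures. M.act u v \<in> H}"
      using M.act_diff_eq_0_iff[of uK "sc (qq powi l)" v] vM K H(2)
      by (simp add: Ures.K Ures.scal Ures_diff)
    show "Kbinom p - sc (qbinom l (int p)) \<in> {u \<in> Ures. M.act u v \<in> H}"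
      using M.act_diff_eq_0_iff[of "Kbinom p" "sc (qbinom l (int p))" v] vM Kp Kp' H(2)
      by (simp add: Ures.scal Ures_diff)
  qed (use e H(2) uE in \<open>auto simp: M.act_def\<close>)
qed

lemma highest_weight_ideal_ann:
  assumes v: "v \<in> weight_space \<epsilon> p M l"
    and e: "cls \<epsilon> uE \<odot>\<^bsub>M\<^esub> v = \<zero>\<^bsub>M\<^esub>" "cls \<epsilon> (divE p) \<odot>\<^bsub>M\<^esub> v = \<zero>\<^bsub>M\<^esub>"
  shows "highest_weight_ideal \<epsilon> p {u \<in> Ures. M.act u v = \<zero>\<^bsub>M\<^esub>} l"
  using highest_weight_ideal_vimage[OF v e, of "{\<zero>\<^bsub>M\<^esub>}"] by (simp add: M.act_zero)

text \<open>
  For a nonzero submodule \<open>H\<close>, the elements mapping the generator \<open>v\<close> into \<open>H\<close> form a highest weight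
  ideal strictly containing the annihilator of \<open>v\<close>.  So this ideal contains \<open>1\<close>, and \<open>v\<close> lies in \<open>H\<close>.
\<close>

lemma highest_weight_module_imp_irreducible:
  assumes hw: "highest_weight_module \<epsilon> p M l"
    and nz: "\<And>k. ev \<epsilon> (qbinom l (int k)) \<noteq> 0"
  shows "irreducible_module (Ueps \<epsilon>) M"
proof -
  obtain v where v: "v \<in> weight_space \<epsilon> p M l" and v0: "v \<noteq> \<zero>\<^bsub>M\<^esub>"
    and e: "cls \<epsilon> uE \<odot>\<^bsub>M\<^esub> v = \<zero>\<^bsub>M\<^esub>" "cls \<epsilon> (divE p) \<odot>\<^bsub>M\<^esub> v = \<zero>\<^bsub>M\<^esub>"
    and gen: "carrier M = {x \<odot>\<^bsub>M\<^esub> v | x. x \<in> carrier (Ueps \<epsilon>)}"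
    using hw by (auto simp: highest_weight_module_def)
  have vM: "v \<in> carrier M" using v by (simp add: weight_space_def)
  have gen': "\<exists>u\<in>Ures. x = M.act u v" if "x \<in> carrier M" for x
    using gen that by (auto simp: M.act_def carrier_Ueps)
  have "H = carrier M" if H: "submodule H (Ueps \<epsilon>) M" "H \<noteq> {\<zero>\<^bsub>M\<^esub>}" for H
  proof -
    interpret H: submodule H "Ueps \<epsilon>" M by (rule H(1))
    have sub: "H \<subseteq> carrier M" and 0: "\<zero>\<^bsub>M\<^esub> \<in> H"
      and plus: "\<And>x y. x \<in> H \<Longrightarrow> y \<in> H \<Longrightarrow> x \<oplus>\<^bsub>M\<^esub> y \<in> H"
      and act: "\<And>u x. u \<in> Ures \<Longrightarrow> x \<in> H \<Longrightarrow> M.act u x \<in> H"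
      using H.subset H.one_closed H.m_closed H.smult_closed by (auto simp: M.act_def carrier_Ueps)
    let ?A = "{u \<in> Ures. M.act u v = \<zero>\<^bsub>M\<^esub>}" and ?B = "{u \<in> Ures. M.act u v \<in> H}"
    have A: "highest_weight_ideal \<epsilon> p ?A l"
      by (rule highest_weight_ideal_ann[OF v e])
    have B: "highest_weight_ideal \<epsilon> p ?B l"
      by (rule highest_weight_ideal_vimage[OF v e sub 0 plus act])
    obtain x where "x \<in> H" "x \<noteq> \<zero>\<^bsub>M\<^esub>" using H(2) 0 by auto
    then obtain u where "u \<in> ?B" "u \<notin> ?A" using gen' sub by blast
    moreover have "?A \<subseteq> ?B" using 0 by auto
    ultimately have "1 \<in> ?B"
      using highest_weight_ideal_subset_imp_eq[OF nz A B] by blast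
    then have "v \<in> H" by (simp add: M.act_1 vM)
    then show ?thesis using gen' act sub by blast
  qed
  moreover have "carrier M \<noteq> {\<zero>\<^bsub>M\<^esub>}" using vM v0 by auto
  ultimately show ?thesis
    using M.left_module_axioms by (auto simp: irreducible_module_def)
qed

end

context odd_root_of_unity
begin

text \<open>
  The two generators have the same annihilator, so \<open>u v \<mapsto> u w\<close> is well defined and injective.
\<close>

lemma highest_weight_module_unique:
  fixes M :: "(uq set, 'b) module" and N :: "(uq set, 'c) module"
  assumes M: "highest_weight_module \<epsilon> p M l" and N: "highest_weight_module \<epsilon> p N l"
    and nz: "\<And>k. ev \<epsilon> (qbinom l (int k)) \<noteq> 0"
  shows "module_iso (Ueps \<epsilon>) M N"
proof -
  interpret M: left_module "Ueps \<epsilon>" M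
    using M by (simp add: highest_weight_module_def type1_def)
  interpret M: module_at_root \<epsilon> p M by unfold_locales simp
  interpret N: left_module "Ueps \<epsilon>" N
    using N by (simp add: highest_weight_module_def type1_def)
  interpret N: module_at_root \<epsilon> p N by unfold_locales simp
  obtain v where v: "v \<in> weight_space \<epsilon> p M l" "v \<noteq> \<zero>\<^bsub>M\<^esub>"
    "cls \<epsilon> uE \<odot>\<^bsub>M\<^esub> v = \<zero>\<^bsub>M\<^esub>" "cls \<epsilon> (divE p) \<odot>\<^bsub>M\<^esub> v = \<zero>\<^bsub>M\<^esub>"
    "carrier M = {x \<odot>\<^bsub>M\<^esub> v | x. x \<in> carrier (Ueps \<epsilon>)}"
    using M by (auto simp: highest_weight_module_def)
  obtain w where w: "w \<in> weight_space \<epsilon> p N l" "w \<noteq> \<zero>\<^bsub>N\<^esub>"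
    "cls \<epsilon> uE \<odot>\<^bsub>N\<^esub> w = \<zero>\<^bsub>N\<^esub>" "cls \<epsilon> (divE p) \<odot>\<^bsub>N\<^esub> w = \<zero>\<^bsub>N\<^esub>"
    "carrier N = {x \<odot>\<^bsub>N\<^esub> w | x. x \<in> carrier (Ueps \<epsilon>)}"
    using N by (auto simp: highest_weight_module_def)
  have vM: "v \<in> carrier M" and wN: "w \<in> carrier N"
    using v(1) w(1) by (simp_all add: weight_space_def)
  have gM: "carrier M = {M.M.act u v | u. u \<in> Ures}" and gN: "carrier N = {N.M.act u w | u. u \<in> Ures}"
    unfolding v(5) w(5) M.M.act_def N.M.act_def carrier_Ueps by blast+
  have "{u \<in> Ures. M.M.act u v = \<zero>\<^bsub>M\<^esub>} = {u \<in> Ures. N.M.act u w = \<zero>\<^bsub>N\<^esub>}"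
    by (rule highest_weight_ideal_unique[OF nz M.highest_weight_ideal_ann[OF v(1,3,4)]
          N.highest_weight_ideal_ann[OF w(1,3,4)]])
      (use v(2) w(2) vM wN in \<open>auto simp: M.M.act_1 N.M.act_1\<close>)
  then have ann: "M.M.act u v = \<zero>\<^bsub>M\<^esub> \<longleftrightarrow> N.M.act u w = \<zero>\<^bsub>N\<^esub>" if "u \<in> Ures" for u
    using that by blast
  have eq_iff: "M.M.act u v = M.M.act u' v \<longleftrightarrow> N.M.act u w = N.M.act u' w" if "u \<in> Ures" "u' \<in> Ures" for u u'
    using ann[of "u - u'"] that vM wN
    by (simp add: Ures_diff M.M.act_diff_eq_0_iff N.M.act_diff_eq_0_iff)
  define h where "h x = N.M.act (SOME u. u \<in> Ures \<and> x = M.M.act u v) w" for x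
  have h: "h (M.M.act u v) = N.M.act u w" if "u \<in> Ures" for u
  proof -
    have "(SOME u'. u' \<in> Ures \<and> M.M.act u v = M.M.act u' v) \<in> Ures \<and>
        M.M.act u v = M.M.act (SOME u'. u' \<in> Ures \<and> M.M.act u v = M.M.act u' v) v"
      by (rule someI[of _ u]) (use that in auto)
    then show ?thesis
      unfolding h_def using eq_iff that by metis
  qed
  have "bij_betw h (carrier M) (carrier N)"
    unfolding bij_betw_def inj_on_def
  proof (intro conjI ballI impI)
    fix x y assume "x \<in> carrier M" "y \<in> carrier M" "h x = h y"
    then show "x = y" using gM h eq_iff by auto
  next
    show "h ` carrier M = carrier N"
      unfolding gM gN using h by (force simp: image_def)
  qed
  moreover have "h (x \<oplus>\<^bsub>M\<^esub> y) = h x \<oplus>\<^bsub>N\<^esub> h y" if x: "x \<in> carrier M" and y: "y \<in> carrier M" for x y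
  proof -
    obtain a b where ab: "a \<in> Ures" "b \<in> Ures" "x = M.M.act a v" "y = M.M.act b v"
      using x y unfolding gM by blast
    then have "x \<oplus>\<^bsub>M\<^esub> y = M.M.act (a + b) v" by (simp add: M.M.act_plus vM)
    then show ?thesis using ab by (simp add: h Ures.add N.M.act_plus wN)
  qed
  moreover have "h (a \<odot>\<^bsub>M\<^esub> x) = a \<odot>\<^bsub>N\<^esub> h x" if a: "a \<in> carrier (Ueps \<epsilon>)" and x: "x \<in> carrier M" for a x
  proof -
    obtain b u where b: "b \<in> Ures" "a = cls \<epsilon> b" "u \<in> Ures" "x = M.M.act u v"
      using a x unfolding gM carrier_Ueps by blast
    then have "a \<odot>\<^bsub>M\<^esub> x = M.M.act (b * u) v" by (simp add: M.M.act_times vM) (simp add: M.M.act_def)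
    moreover have "N.M.act (b * u) w = a \<odot>\<^bsub>N\<^esub> h x" using b wN by (simp add: N.M.act_times h) (simp add: N.M.act_def)
    ultimately show ?thesis using b by (simp add: h Ures.mult)
  qed
  ultimately show ?thesis
    unfolding module_iso_def by blast
qed

end

section \<open>The submodules of the \<open>q\<close>-Fock space\<close>

interpretation fock: vector_space fscale
  by (rule vector_space_fscale)

lemma qbinom_symmetric: "qbinom (int (a + b)) (int a) = qbinom (int (a + b)) (int b)"
  using qbinom_qfact[of a b] qbinom_qfact[of b a] by (simp add: add.commute mult.commute)

lemma gvec_nat: "gvec (int a) (int b) = Poly_Mapping.single (a, b) 1"
  by (simp add: gvec_def)

lemma gvec_neg: "i < 0 \<or> j < 0 \<Longrightarrow> gvec i j = 0"
  by (auto simp: gvec_def)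

lemma fscale_gvec: "fscale c (gvec (int a) (int b)) = Poly_Mapping.single (a, b) c"
  by (rule poly_mapping_eqI) (auto simp: gvec_nat lookup_single when_def)

lemma sum_keys_single: "(\<Sum>x\<in>Poly_Mapping.keys v. Poly_Mapping.single x (Poly_Mapping.lookup v x)) = v"
  by (rule poly_mapping_eqI)
    (auto simp: lookup_sum lookup_single when_def in_keys_iff)

definition V_basis :: "int \<Rightarrow> fock set" where
  "V_basis s = {gvec i (i + s) | i. i \<ge> 0}"

lemma gvec_in_span: "gvec i (i + s) \<in> fock.span (V_basis s)"
proof (cases "i \<ge> 0")
  case True
  then show ?thesis by (intro fock.span_base) (auto simp: V_basis_def)
next
  case False
  then show ?thesis by (simp add: gvec_neg fock.span_zero)
qed

lemma keys_span_V_basis: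
  assumes "v \<in> fock.span (V_basis s)" "(a, b) \<in> Poly_Mapping.keys v"
  shows "int b = int a + s"
proof -
  let ?P = "{v. \<forall>a b. Poly_Mapping.lookup v (a, b) \<noteq> 0 \<longrightarrow> int b = int a + s}"
  have "fock.subspace ?P"
    by (rule fock.subspaceI) (auto simp: lookup_add, metis add_0)
  moreover have "V_basis s \<subseteq> ?P"
    by (auto simp: V_basis_def lookup_gvec split: if_splits)
  ultimately have "fock.span (V_basis s) \<subseteq> ?P"
    by (rule fock.span_minimal[rotated])
  then show ?thesis
    using assms by (auto simp: in_keys_iff)
qed

lemma left_module_restrict:
  assumes "left_module R M" and H: "H \<subseteq> carrier M" "\<zero>\<^bsub>M\<^esub> \<in> H"
    and plus: "\<And>x y. x \<in> H \<Longrightarrow> y \<in> H \<Longrightarrow> x \<oplus>\<^bsub>M\<^esub> y \<in> H"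
    and act: "\<And>a x. a \<in> carrier R \<Longrightarrow> x \<in> H \<Longrightarrow> a \<odot>\<^bsub>M\<^esub> x \<in> H"
  shows "left_module R (M\<lparr>carrier := H\<rparr>)"
proof -
  interpret left_module R M by fact
  have sub: "x \<in> carrier M" if "x \<in> H" for x
    using that H by blast
  have neg: "\<ominus>\<^bsub>R\<^esub> \<one>\<^bsub>R\<^esub> \<odot>\<^bsub>M\<^esub> x \<oplus>\<^bsub>M\<^esub> x = \<zero>\<^bsub>M\<^esub>" if "x \<in> H" for x
  proof -
    have z: "\<zero>\<^bsub>R\<^esub> \<odot>\<^bsub>M\<^esub> x = \<zero>\<^bsub>M\<^esub>"
      using smult_l_distr[of "\<zero>\<^bsub>R\<^esub>" "\<zero>\<^bsub>R\<^esub>" x] smult_closed[of "\<zero>\<^bsub>R\<^esub>" x] sub[OF that]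
      by simp
    show ?thesis
      using smult_l_distr[of "\<ominus>\<^bsub>R\<^esub> \<one>\<^bsub>R\<^esub>" "\<one>\<^bsub>R\<^esub>" x] z smult_one sub[OF that] by (simp add: R.l_neg)
  qed
  have "abelian_group (M\<lparr>carrier := H\<rparr>)"
  proof (rule abelian_groupI)
    fix x assume "x \<in> carrier (M\<lparr>carrier := H\<rparr>)"
    then show "\<exists>y\<in>carrier (M\<lparr>carrier := H\<rparr>). y \<oplus>\<^bsub>M\<lparr>carrier := H\<rparr>\<^esub> x = \<zero>\<^bsub>M\<lparr>carrier := H\<rparr>\<^esub>"
      using neg by (intro bexI[of _ "\<ominus>\<^bsub>R\<^esub> \<one>\<^bsub>R\<^esub> \<odot>\<^bsub>M\<^esub> x"]) (auto intro!: act)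
  qed (use H plus sub in \<open>auto simp: a_ac\<close>)
  moreover have "left_module_axioms R (M\<lparr>carrier := H\<rparr>)"
    by unfold_locales (use sub act in \<open>auto simp: smult_l_distr smult_r_distr smult_assoc smult_one\<close>)
  ultimately show ?thesis
    by (simp add: left_module_def R.ring_axioms)
qed

locale fock_module = odd_root_of_unity +
  fixes F :: "(uq set, fock) module"
  assumes F: "restricted_fock \<epsilon> F"
begin

lemma F_simps [simp]: "carrier F = UNIV" "add F = (+)" "zero F = 0" "cscale \<epsilon> F z v = fscale z v"
  using F by (simp_all add: restricted_fock_def)

sublocale Ueps_module \<epsilon> F
proof -
  have "left_module (Ueps \<epsilon>) F"
    using F by (simp add: restricted_fock_def)
  then show "Ueps_module \<epsilon> F"
    by (simp add: Ueps_module_def Ueps_module_axioms_def)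
qed

lemma act_K: "i \<ge> 0 \<Longrightarrow> j \<ge> 0 \<Longrightarrow> act uK (gvec i j) = fscale (\<epsilon> powi (- (i + j + 1))) (gvec i j)"
  and act_Ki: "i \<ge> 0 \<Longrightarrow> j \<ge> 0 \<Longrightarrow> act uKi (gvec i j) = fscale (\<epsilon> powi (i + j + 1)) (gvec i j)"
  and act_E: "i \<ge> 0 \<Longrightarrow> j \<ge> 0 \<Longrightarrow> r \<ge> 1 \<Longrightarrow> act (divE r) (gvec i j)
    = fscale (ev \<epsilon> (qbinom j (j - int r))) (gvec (i - int r) (j - int r))"
  and act_F: "i \<ge> 0 \<Longrightarrow> j \<ge> 0 \<Longrightarrow> r \<ge> 1 \<Longrightarrow> act (divF r) (gvec i j)
    = fscale ((-1) ^ r * ev \<epsilon> (qbinom (int r + i) (int r))) (gvec (i + int r) (j + int r))"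
  using F unfolding restricted_fock_def act_def by blast+

lemma act_scalar: "act (sc (const z)) x = fscale z x"
  using act_laurent[of "const z" x] by simp

lemma act_fscale: "u \<in> Ures \<Longrightarrow> act u (fscale z x) = fscale z (act u x)"
  using act_times[of u "sc (const z)" x] act_times[of "sc (const z)" u x]
  by (simp add: Ures.scal sc_central flip: act_scalar)

text \<open>
  All generators shift both indices of \<open>g\<close> by the same amount.
\<close>

lemma act_span:
  assumes u: "u \<in> Ures" and "v \<in> fock.span (V_basis s)"
  shows "act u v \<in> fock.span (V_basis s)"
  using assms
proof (induction u arbitrary: v rule: Ures.induct)
  have lift: "act u v \<in> fock.span (V_basis s)"
    if u: "u \<in> Ures" and v: "v \<in> fock.span (V_basis s)"
      and base: "\<And>i. i \<ge> 0 \<Longrightarrow> i + s \<ge> 0 \<Longrightarrow> act u (gvec i (i + s)) \<in> fock.span (V_basis s)" for u v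
  proof -
    have "fock.subspace {v. act u v \<in> fock.span (V_basis s)}"
      using u act_zero[OF u] act_add[OF u]
      by (intro fock.subspaceI) (auto simp: act_fscale intro: fock.span_zero fock.span_add fock.span_scale)
    moreover have "V_basis s \<subseteq> {v. act u v \<in> fock.span (V_basis s)}"
    proof
      fix x assume "x \<in> V_basis s"
      then obtain i where i: "i \<ge> 0" "x = gvec i (i + s)" by (auto simp: V_basis_def)
      show "x \<in> {v. act u v \<in> fock.span (V_basis s)}"
        using base[of i] i act_zero[OF u] by (cases "i + s \<ge> 0") (auto simp: gvec_neg fock.span_zero)
    qed
    ultimately show ?thesis
      using fock.span_minimal v by blast
  qed
  {
    case (scal a)
    then show ?case using act_laurent[of a v] by (simp add: fock.span_scale)
  next
    case K
    show ?case
      by (rule lift[OF Ures.K K.prems]) (simp only: act_K fock.span_scale gvec_in_span)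
  next
    case Ki
    show ?case
      by (rule lift[OF Ures.Ki Ki.prems]) (simp only: act_Ki fock.span_scale gvec_in_span)
  next
    case (E r)
    have "gvec (i - int r) (i + s - int r) \<in> fock.span (V_basis s)" for i
      using gvec_in_span[of "i - int r" s] by (simp add: algebra_simps)
    then show ?case
      using E.hyps by (intro lift[OF divE_Ures E.prems]) (simp only: act_E fock.span_scale)
  next
    case (F r)
    have "gvec (i + int r) (i + s + int r) \<in> fock.span (V_basis s)" for i
      using gvec_in_span[of "i + int r" s] by (simp add: algebra_simps)
    then show ?case
      using F.hyps by (intro lift[OF divF_Ures F.prems]) (simp only: act_F fock.span_scale)
  next
    case (add x y)
    then show ?case using act_plus[of x y v] by (simp add: fock.span_add)
  next
    case (mult x y)
    then show ?case using act_times[of x y v] by simp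
  }
qed

lemma carrier_Vs: "carrier (Vs F s) = fock.span (V_basis s)"
  by (simp add: Vs_def V_basis_def)

lemma Vs_simps: "add (Vs F s) = (+)" "zero (Vs F s) = 0" "smult (Vs F s) = smult F"
  "cscale \<epsilon> (Vs F s) z v = fscale z v"
  using F_simps by (simp_all add: Vs_def cscale_def del: F_simps)

lemma left_module_Vs: "left_module (Ueps \<epsilon>) (Vs F s)"
proof -
  have "left_module (Ueps \<epsilon>) (F\<lparr>carrier := fock.span (V_basis s)\<rparr>)"
    by (rule left_module_restrict[OF left_module_axioms])
      (use act_span[of _ _ s] in \<open>auto simp: carrier_Ueps act_def intro: fock.span_zero fock.span_add\<close>)
  then show ?thesis by (simp add: Vs_def V_basis_def)
qed

lemma finsum_Vs: "finite S \<Longrightarrow> S \<subseteq> carrier (Vs F s) \<Longrightarrow> finsum (Vs F s) (\<lambda>w. w) S = \<Sum>S"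
proof -
  interpret V: left_module "Ueps \<epsilon>" "Vs F s" by (rule left_module_Vs)
  show "finite S \<Longrightarrow> S \<subseteq> carrier (Vs F s) \<Longrightarrow> finsum (Vs F s) (\<lambda>w. w) S = \<Sum>S"
  proof (induction S rule: finite_induct)
    case (insert x S)
    then have "finsum (Vs F s) (\<lambda>w. w) (insert x S) = x \<oplus>\<^bsub>Vs F s\<^esub> finsum (Vs F s) (\<lambda>w. w) S"
      by (intro V.finsum_insert) auto
    with insert show ?case by (simp add: Vs_simps)
  qed (simp add: Vs_simps)
qed

lemma act_power:
  assumes "u \<in> Ures" "act u x = fscale c x"
  shows "u ^ n \<in> Ures \<and> act (u ^ n) x = fscale (c ^ n) x"
proof (induction n)
  case 0
  then show ?case using act_1[of x] by simp
next
  case (Suc n)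
  then show ?case
    using assms by (simp add: act_times act_fscale Ures.mult mult.commute)
qed

lemma act_eq_id_on_Vs:
  assumes "u \<in> Ures" "\<And>i j. i \<ge> 0 \<Longrightarrow> j \<ge> 0 \<Longrightarrow> act u (gvec i j) = gvec i j" "v \<in> fock.span (V_basis s)"
  shows "act u v = v"
proof -
  have "fock.subspace {v. act u v = v}"
    using assms(1) act_zero[OF assms(1)] act_add[OF assms(1)] by (intro fock.subspaceI) (auto simp: act_fscale)
  moreover have "act u (gvec i j) = gvec i j" for i j
    using assms(2) act_zero[OF assms(1)] by (cases "i < 0 \<or> j < 0") (auto simp: gvec_neg)
  then have "V_basis s \<subseteq> {v. act u v = v}"
    by (auto simp: V_basis_def)
  ultimately show ?thesis
    using fock.span_minimal assms(3) by blast
qed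

text \<open>
  The summands in the decomposition of \<open>v\<close> into eigenvectors of \<open>K\<close> are the multiples of basis
  vectors occurring in \<open>v\<close>.  They are pairwise distinct, so their sum may be taken over a set.
\<close>

lemma type1_Vs: "type1 \<epsilon> p (Vs F s)"
  unfolding type1_def
proof (intro conjI ballI left_module_Vs)
  fix v assume v: "v \<in> carrier (Vs F s)"
  define S where "S = (\<lambda>x. Poly_Mapping.single x (Poly_Mapping.lookup v x)) ` Poly_Mapping.keys v"
  have inj: "inj_on (\<lambda>x. Poly_Mapping.single x (Poly_Mapping.lookup v x)) (Poly_Mapping.keys v)"
    by (rule inj_onI) (metis in_keys_iff lookup_single_eq lookup_single_not_eq)
  have S: "\<exists>c a. w = fscale c (gvec (int a) (int a + s)) \<and> int a + s \<ge> 0" if w: "w \<in> S" for w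
  proof -
    obtain x where x: "x \<in> Poly_Mapping.keys v" "w = Poly_Mapping.single x (Poly_Mapping.lookup v x)"
      using w unfolding S_def by blast
    obtain a b where ab: "x = (a, b)"
      by (cases x)
    have "int b = int a + s"
      using keys_span_V_basis[OF _ x(1)[unfolded ab]] v by (simp add: carrier_Vs)
    then show ?thesis using x(2) unfolding ab by (metis fscale_gvec of_nat_0_le_iff)
  qed
  then have sub: "S \<subseteq> carrier (Vs F s)"
    by (force simp: carrier_Vs intro: fock.span_scale gvec_in_span)
  have "finsum (Vs F s) (\<lambda>w. w) S = v"
    using finsum_Vs[OF _ sub] sum_keys_single[of v] by (simp add: S_def sum.reindex[OF inj])
  moreover have "\<exists>c. cls \<epsilon> uK \<odot>\<^bsub>Vs F s\<^esub> w = cscale \<epsilon> (Vs F s) c w" if "w \<in> S" for w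
  proof -
    obtain c a where w: "w = fscale c (gvec (int a) (int a + s))" "int a + s \<ge> 0" using S \<open>w \<in> S\<close> by blast
    then have "act uK w = fscale (\<epsilon> powi (- (int a + (int a + s) + 1))) w"
      using act_K[of "int a" "int a + s"] by (simp add: act_fscale Ures.K mult.commute)
    then show ?thesis by (auto simp: Vs_simps act_def)
  qed
  moreover have "finite S" by (simp add: S_def)
  ultimately show "\<exists>S. finite S \<and> S \<subseteq> {w \<in> carrier (Vs F s). \<exists>c. cls \<epsilon> uK \<odot>\<^bsub>Vs F s\<^esub> w = cscale \<epsilon> (Vs F s) c w} \<and>
      v = finsum (Vs F s) (\<lambda>w. w) S"
    using sub by (intro exI[of _ S]) auto
next
  fix v assume v: "v \<in> carrier (Vs F s)"
  have 1: "(\<epsilon> powi k) ^ p = 1" for k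
    using eps_powi_eq_1_iff[of "k * int p"] by (simp only: power_int_mult power_int_of_nat dvd_triv_right)
  have "uK ^ p \<in> Ures \<and> act (uK ^ p) (gvec i j) = gvec i j"
    "uKi ^ p \<in> Ures \<and> act (uKi ^ p) (gvec i j) = gvec i j" if "i \<ge> 0" "j \<ge> 0" for i j
    using act_power[OF Ures.K act_K[OF that], of p] act_power[OF Ures.Ki act_Ki[OF that], of p]
    unfolding 1 by simp_all
  then show "cls \<epsilon> (uK ^ p) \<odot>\<^bsub>Vs F s\<^esub> v = v" "cls \<epsilon> (uKi ^ p) \<odot>\<^bsub>Vs F s\<^esub> v = v"
    using act_eq_id_on_Vs[of "uK ^ p" v s] act_eq_id_on_Vs[of "uKi ^ p" v s] v
    unfolding carrier_Vs Vs_simps act_def[symmetric] by blast+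
qed

text \<open>
  All other summands of the commutation formula end with a divided power of \<open>e\<close>.
\<close>

lemma act_Kbinom:
  assumes "\<And>k. k > 0 \<Longrightarrow> act (divE k) v = 0"
  shows "act (Kbinom t) v = act (divE t) (act (divF t) v)"
proof -
  define T where "T u = divFz (int t - int u) * kbinom (2 * int u - int t - int t) u * divE (t - u)" for u
  have "divE t * divF t = (\<Sum>u<t. T u) + kbinom 0 t"
    using divE_mult_divFz[of t "int t"] divFz_int[of 0]
    unfolding lessThan_Suc_atMost[symmetric] sum.lessThan_Suc by (simp add: T_def)
  moreover have T: "T u \<in> Ures" for u
    unfolding T_def by (intro Ures.mult kbinom_Ures) auto
  moreover have "n \<le> t \<Longrightarrow> act (\<Sum>u<n. T u) v = 0" for n
  proof (induction n)
    case 0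
    then show ?case using act_0[of v] by simp
  next
    case (Suc n)
    have "act (T n) v = act (divFz (int t - int n) * kbinom (2 * int n - int t - int t) n) (act (divE (t - n)) v)"
      unfolding T_def by (rule act_times) (auto intro: Ures.mult kbinom_Ures)
    also have "\<dots> = 0"
      using Suc.prems assms[of "t - n"] act_zero by (simp add: Ures.mult kbinom_Ures)
    finally show ?case
      using Suc act_plus[of "\<Sum>u<n. T u" "T n" v] T by (simp add: Ures_sum)
  qed
  ultimately have "act (divE t * divF t) v = act (kbinom 0 t) v"
    using act_plus[of "\<Sum>u<t. T u" "kbinom 0 t" v] by (simp add: Ures_sum kbinom_Ures)
  then show ?thesis
    by (simp add: act_times Kbinom_eq_kbinom)
qed

text \<open>
  In both cases the generator is \<open>g(i\<^sub>0, j\<^sub>0)\<close> with \<open>{i\<^sub>0, j\<^sub>0} = {0, rp}\<close> and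
  \<open>j\<^sub>0 - i\<^sub>0 = s\<close>, and the basis vectors are \<open>g(i\<^sub>0 + k, j\<^sub>0 + k)\<close>.  Since one index is \<open>0\<close>, every
  \<open>e\<^bsup>(k)\<^esup>\<close> with \<open>k > 0\<close> kills the generator.
\<close>

lemma highest_weight_module_Vs:
  fixes r :: nat
  assumes s: "s = int (r * p) \<or> s = - int (r * p)"
  shows "highest_weight_module \<epsilon> p (Vs F s) (- (int (r * p) + 1))"
proof -
  define i0 j0 where "i0 = nat (- s)" and "j0 = nat s"
  define g where "g k = gvec (int (i0 + k)) (int (j0 + k))" for k
  have ij: "i0 = 0 \<and> j0 = r * p \<or> i0 = r * p \<and> j0 = 0" "int j0 = int i0 + s"
    using s by (auto simp: i0_def j0_def simp del: of_nat_mult)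
  define c where "c k = (-1) ^ k * ev \<epsilon> (qbinom (int (k + i0)) (int k))" for k
  have c: "c k \<noteq> 0" for k
    using ij(1) ev_qbinom_multiple_add_nonzero[of r k] ev_qbinom_multiple_add_nonzero[of 0 k] by (auto simp: c_def add.commute)
  have F: "act (divF k) (g 0) = fscale (c k) (g k)" for k
  proof (cases "k = 0")
    case True
    then show ?thesis using act_1 by (simp add: c_def)
  next
    case False
    then show ?thesis using act_F[of "int i0" "int j0" k] by (simp add: g_def c_def)
  qed
  have E: "act (divE k) (g 0) = 0" if "k > 0" for k
    using act_E[of "int i0" "int j0" k] ij(1) that by (auto simp: g_def gvec_neg)
  have gV: "g k \<in> fock.span (V_basis s)" for k
    using gvec_in_span[of "int (i0 + k)" s] ij(2) by (simp add: g_def algebra_simps)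
  have K: "act uK (g 0) = fscale (\<epsilon> powi (- (int (r * p) + 1))) (g 0)"
    using act_K[of "int i0" "int j0"] ij(1) by (auto simp: g_def simp del: minus_add_distrib)
  have "act (divE p) (g p) = fscale (ev \<epsilon> (qbinom (int (j0 + p)) (int j0))) (g 0)"
    using act_E[of "int (i0 + p)" "int (j0 + p)" p] p_gt_1 by (simp add: g_def)
  then have "act (Kbinom p) (g 0) = fscale (c p * ev \<epsilon> (qbinom (int (j0 + p)) (int j0))) (g 0)"
    by (subst act_Kbinom) (simp_all add: E F act_fscale)
  also have "c p * ev \<epsilon> (qbinom (int (j0 + p)) (int j0)) = (- 1) ^ p * ev \<epsilon> (qbinom (int (r * p + p)) (int p))"
    using ij(1) qbinom_symmetric[of "r * p" p] by (auto simp: c_def add.commute)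
  also have "\<dots> = ev \<epsilon> (qbinom (- (int (r * p) + 1)) (int p))"
    unfolding qbinom_neg using odd_p by (simp add: ev_uminus)
  finally have Kp: "act (Kbinom p) (g 0) = fscale (ev \<epsilon> (qbinom (- (int (r * p) + 1)) (int p))) (g 0)" .
  have "Poly_Mapping.lookup (g 0) (i0, j0) = 1"
    by (simp add: g_def lookup_gvec)
  then have "g 0 \<noteq> 0" by auto
  moreover have "g 0 \<in> weight_space \<epsilon> p (Vs F s) (- (int (r * p) + 1))"
    using K Kp gV[of 0] by (simp add: weight_space_def carrier_Vs Vs_simps act_def)
  moreover have "carrier (Vs F s) = {x \<odot>\<^bsub>Vs F s\<^esub> g 0 | x. x \<in> carrier (Ueps \<epsilon>)}"
  proof -
    let ?G = "{act u (g 0) | u. u \<in> Ures}"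
    have "fock.subspace ?G"
    proof (rule fock.subspaceI)
      show "0 \<in> ?G" using act_0[of "g 0"] by force
      show "x + y \<in> ?G" if "x \<in> ?G" "y \<in> ?G" for x y
      proof -
        obtain u w where uw: "u \<in> Ures" "w \<in> Ures" "x = act u (g 0)" "y = act w (g 0)"
          using \<open>x \<in> ?G\<close> \<open>y \<in> ?G\<close> by blast
        then have "x + y = act (u + w) (g 0)"
          by (simp add: act_plus)
        then show ?thesis using uw(1,2) by (auto intro: Ures.add)
      qed
      show "fscale z x \<in> ?G" if "x \<in> ?G" for z x
      proof -
        obtain u where u: "u \<in> Ures" "x = act u (g 0)" using \<open>x \<in> ?G\<close> by blast
        then have "fscale z x = act (sc (const z) * u) (g 0)"
          by (simp add: act_times Ures.scal act_scalar)
        then show ?thesis using u(1) by (auto intro: Ures.mult Ures.scal)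
      qed
    qed
    moreover have "V_basis s \<subseteq> ?G"
    proof
      fix x assume "x \<in> V_basis s"
      then obtain i where i: "i \<ge> 0" "x = gvec i (i + s)" by (auto simp: V_basis_def)
      show "x \<in> ?G"
      proof (cases "i + s \<ge> 0")
        case True
        define k where "k = nat (i - int i0)"
        have "i = int (i0 + k)" "i + s = int (j0 + k)"
          using True i(1) by (auto simp: k_def i0_def j0_def)
        then have "x = g k" by (simp only: i(2) g_def)
        also have "\<dots> = act (sc (const (1 / c k)) * divF k) (g 0)"
          using c[of k] by (simp add: act_times Ures.scal F act_scalar)
        finally show ?thesis by (auto intro: Ures.mult Ures.scal)
      next
        case False
        then have "x = act 0 (g 0)" using act_0[of "g 0"] i by (simp add: gvec_neg)
        then show ?thesis by blast
      qed
    qed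
    ultimately have "fock.span (V_basis s) \<subseteq> ?G"
      by (rule fock.span_minimal[rotated])
    moreover have "?G \<subseteq> fock.span (V_basis s)"
      using act_span gV by blast
    ultimately show ?thesis
      unfolding carrier_Vs Vs_simps carrier_Ueps by (auto simp: act_def)
  qed
  ultimately show ?thesis
    unfolding highest_weight_module_def
    using type1_Vs E[of 1] E[of p] p_gt_1
    by (intro conjI bexI[of _ "g 0"]) (simp_all add: Vs_simps act_def)
qed

end

theorem proposition5p1:
  fixes \<epsilon> :: complex and p r :: nat and s :: int
    and F :: "(uq set, fock) module" and M :: "(uq set, 'b) module"
  assumes "odd p" and "1 < p"
    and "\<epsilon> ^ p = 1" and "\<And>k. 0 < k \<Longrightarrow> k < p \<Longrightarrow> \<epsilon> ^ k \<noteq> 1"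
    and "restricted_fock \<epsilon> F"
    and "s = int (r * p) \<or> s = - int (r * p)"
  shows "is_Vres \<epsilon> p (Vs F s) (- (int (r * p) + 1)) \<and>
    (is_Vres \<epsilon> p M (- (int (r * p) + 1)) \<longrightarrow> module_iso (Ueps \<epsilon>) (Vs F s) M)"
proof -
  interpret fock_module \<epsilon> p F
    using assms(1-5) by unfold_locales
  let ?l = "- (int (r * p) + 1)"
  have hw: "highest_weight_module \<epsilon> p (Vs F s) ?l"
    using assms(6) by (rule highest_weight_module_Vs)
  interpret V: left_module "Ueps \<epsilon>" "Vs F s"
    by (rule left_module_Vs)
  interpret V: module_at_root \<epsilon> p "Vs F s"
    by unfold_locales simp
  have "is_Vres \<epsilon> p (Vs F s) ?l"
    using hw V.highest_weight_module_imp_irreducible[OF hw ev_qbinom_nonzero]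
    by (simp add: is_Vres_def)
  moreover have "module_iso (Ueps \<epsilon>) (Vs F s) M" if "is_Vres \<epsilon> p M ?l"
    using highest_weight_module_unique[OF hw _ ev_qbinom_nonzero] that
    unfolding is_Vres_def by blast
  ultimately show ?thesis by blast
qed

end
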